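(* Let $P=\sum_{\alpha\in\mathbb{N}^n}a_\alpha(t)\mathbf{z}^\alpha\in\mathbb{C}\{t\}[z_1,\ldots,z_n]$ and suppose that $\operatorname{supp}(P)$ has constant parity. If $P$ has the half-plane property, then $\operatorname{trop}(P)$ is an $M$-concave function.
   Context: $\mathbb{R}\{t\}$ denotes the real field of generalized Puiseux series, i.e. formal series $x(t)=\sum_{-k\in A}a_k t^k$ with $A\subset\mathbb{R}$ well ordered and $a_k\in\mathbb{R}$. $\mathbb{C}\{t\}=\{x+iy: x,y\in\mathbb{R}\{t\}\}$, with $\Re(x+iy)=x$, $\Im(x+iy)=y$. The valuation $\nu:\mathbb{C}\{t\}\to\mathbb{R}\cup\{-\infty\}$ sends a series to its leading (largest) exponent, with $\nu(0)=-\infty$. A real series is positive if its leading coefficient is positive. For $\theta\in\mathbb{R}$ let $H_\theta=\{z\in\mathbb{C}\{t\}:\Im(e^{i\theta}z)>0\}$. A polynomial $P\in\mathbb{C}\{t\}[\mathbf{z}]$ is $H_\theta$-stable if $P(\mathbf{z})\neq0$ whenever all $z_j\in H_\theta$; it has the half-plane property if it is $H_\theta$-stable for some $\theta\in\mathbb{R}$. The support of $P=\sum a_\alpha(t)\mathbf{z}^\alpha$ is $\operatorname{supp}(P)=\{\alpha: a_\alpha(t)\neq0\}$, and $\operatorname{trop}(P):\operatorname{supp}(P)\to\mathbb{R}$ is $\alpha\mapsto\nu(a_\alpha(t))$. For $\alpha\in\mathbb{Z}^n$ let $|\alpha|=\sum_i|\alpha_i|$. A set $\mathcal{A}\subseteq\mathbb{Z}^n$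 has constant parity if $|\alpha|-|\beta|$ is even for all $\alpha,\beta\in\mathcal{A}$. For $\alpha,\beta\in\mathbb{Z}^n$, a step from $\alpha$ to $\beta$ is $s\in\mathbb{Z}^n$ with $|s|=1$ and $|\alpha+s-\beta|=|\alpha-\beta|-1$; write $\alpha\xrightarrow{s}\beta$. A function $f:\mathcal{J}\to\mathbb{R}$, $\mathcal{J}\subseteq\mathbb{Z}^n$, is $M$-concave if for all $\alpha,\beta\in\mathcal{J}$ and every step $s$ with $\alpha\xrightarrow{s}\beta$ there is a step $t$ with $\alpha+s\xrightarrow{t}\beta$, $\alpha+s+t\in\mathcal{J}$, $\beta-s-t\in\mathcal{J}$ and $f(\alpha)+f(\beta)\le f(\alpha+s+t)+f(\beta-s-t)$. *)

theory Defs
  imports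
    "HOL-Analysis.Analysis"
    "HOL-Library.Poly_Mapping"
begin

section \<open>Well-ordered sets of reals\<close>

lemma wo_real_iff_min:
  fixes A :: "real set"
  shows "wfp_on A (<) \<longleftrightarrow> (\<forall>B\<subseteq>A. B \<noteq> {} \<longrightarrow> (\<exists>m\<in>B. \<forall>b\<in>B. m \<le> b))"
proof -
  have "(\<forall>y. y < m \<longrightarrow> y \<notin> B) \<longleftrightarrow> (\<forall>b\<in>B. m \<le> b)" for m :: real and B
    by (auto simp: not_less[symmetric])
  then show ?thesis unfolding wfp_on_iff_ex_minimal by simp
qed

lemma wo_real_minE:
  fixes A :: "real set"
  assumes "wfp_on A (<)" "B \<subseteq> A" "B \<noteq> {}"
  obtains m where "m \<in> B" "\<And>b. b \<in> B \<Longrightarrow> m \<le> b"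
proof -
  have "\<exists>m\<in>B. \<forall>b\<in>B. m \<le> b"
    using assms(1)[unfolded wo_real_iff_min, rule_format, OF assms(2,3)] by simp
  then show thesis using that by blast
qed

lemma wo_real_no_descending:
  fixes A :: "real set"
  assumes "wfp_on A (<)" "\<And>n. s n \<in> A" "\<And>n. s (Suc n) < s n"
  shows False
proof -
  obtain m where m: "m \<in> range s" "\<And>b. b \<in> range s \<Longrightarrow> m \<le> b"
    using wo_real_minE[OF assms(1), of "range s"] assms(2) by blast
  then obtain n where "m = s n" by blast
  with m(2)[of "s (Suc n)"] assms(3)[of n] show False by simp
qed

lemma wo_real_of_no_descending:
  fixes A :: "real set"
  assumes "\<And>s :: nat \<Rightarrow> real. (\<And>n. s n \<in> A) \<Longrightarrow> (\<And>n. s (Suc n) < s n) \<Longrightarrow> False"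
  shows "wfp_on A (<)"
proof (rule ccontr)
  assume "\<not> wfp_on A (<)"
  then obtain B where B: "B \<subseteq> A" "B \<noteq> {}" "\<And>m. m \<in> B \<Longrightarrow> \<exists>b\<in>B. b < m"
    unfolding wo_real_iff_min by (meson not_le)
  from B(2) obtain b0 where b0: "b0 \<in> B" by blast
  define s where "s = rec_nat b0 (\<lambda>_ m. SOME b. b \<in> B \<and> b < m)"
  have s0: "s 0 = b0" and sS: "s (Suc n) = (SOME b. b \<in> B \<and> b < s n)" for n
    by (simp_all add: s_def)
  have ex: "m \<in> B \<Longrightarrow> (SOME b. b \<in> B \<and> b < m) \<in> B \<and> (SOME b. b \<in> B \<and> b < m) < m" for m
    using someI_ex[of "\<lambda>b. b \<in> B \<and> b < m"] B(3)[of m] by blast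
  have inB: "s n \<in> B" for n
  proof (induction n)
    case 0
    show ?case using b0 by (simp only: s0)
  next
    case (Suc n)
    show ?case unfolding sS using ex[OF Suc] by (rule conjunct1)
  qed
  have "s (Suc n) < s n" for n
    unfolding sS using ex[OF inB[of n]] by (rule conjunct2)
  then show False using assms[of s] inB B(1) by blast
qed

lemma wo_real_mono_subseq:
  fixes A :: "real set" and s :: "nat \<Rightarrow> real"
  assumes "wfp_on A (<)" "\<And>n. s n \<in> A"
  obtains r :: "nat \<Rightarrow> nat" where "strict_mono r" "incseq (s \<circ> r)"
proof -
  obtain f :: "nat \<Rightarrow> nat" where f: "strict_mono f" "monoseq (\<lambda>n. s (f n))"
    using seq_monosub by blast
  from f(2) consider "incseq (s \<circ> f)" | "decseq (s \<circ> f)"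
    by (auto simp: monoseq_iff o_def)
  then show ?thesis
  proof cases
    case 1
    with f(1) that show ?thesis by blast
  next
    case 2
    obtain m where m: "m \<in> range (s \<circ> f)" "\<And>b. b \<in> range (s \<circ> f) \<Longrightarrow> m \<le> b"
      using wo_real_minE[OF assms(1), of "range (s \<circ> f)"] assms(2) by (auto simp: image_subset_iff)
    then obtain N where N: "m = s (f N)" by auto
    have const: "s (f (n + N)) = m" for n
      using m(2)[of "s (f (n + N))"] decseqD[OF 2, of N "n + N"] N by auto
    show ?thesis
    proof (rule that)
      show "strict_mono (\<lambda>n. f (n + N))"
        using f(1) by (simp add: strict_mono_def)
      show "incseq (s \<circ> (\<lambda>n. f (n + N)))"
        by (simp add: incseq_def const)
    qed
  qed
qed

lemma wo_real_union:
  fixes A B :: "real set"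
  assumes "wfp_on A (<)" "wfp_on B (<)"
  shows "wfp_on (A \<union> B) (<)"
  unfolding wo_real_iff_min
proof (intro allI impI)
  fix C assume C: "C \<subseteq> A \<union> B" "C \<noteq> {}"
  show "\<exists>m\<in>C. \<forall>b\<in>C. m \<le> b"
  proof (cases "C \<inter> A = {} \<or> C \<inter> B = {}")
    case True
    with C have "C \<subseteq> A \<or> C \<subseteq> B" by blast
    with C(2) assms show ?thesis unfolding wo_real_iff_min by blast
  next
    case False
    obtain m where m: "m \<in> C \<inter> A" "\<And>b. b \<in> C \<inter> A \<Longrightarrow> m \<le> b"
      using wo_real_minE[OF assms(1), of "C \<inter> A"] False by blast
    obtain k where k: "k \<in> C \<inter> B" "\<And>b. b \<in> C \<inter> B \<Longrightarrow> k \<le> b"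
      using wo_real_minE[OF assms(2), of "C \<inter> B"] False by blast
    have "min m k \<in> C" using m k by (simp add: min_def)
    moreover have "\<forall>b\<in>C. min m k \<le> b"
      using C(1) m(2) k(2) by (auto simp: min_le_iff_disj)
    ultimately show ?thesis by blast
  qed
qed

lemma wo_real_sums:
  fixes A B :: "real set"
  assumes "wfp_on A (<)" "wfp_on B (<)"
  shows "wfp_on {a + b | a b. a \<in> A \<and> b \<in> B} (<)"
proof (rule wo_real_of_no_descending)
  fix s :: "nat \<Rightarrow> real"
  assume s: "\<And>n. s n \<in> {a + b | a b. a \<in> A \<and> b \<in> B}" "\<And>n. s (Suc n) < s n"
  have "\<exists>p. fst p \<in> A \<and> snd p \<in> B \<and> s n = fst p + snd p" for n
    using s(1)[of n] by fastforce
  then obtain p where p: "\<And>n. fst (p n) \<in> A \<and> snd (p n) \<in> B \<and> s n = fst (p n) + snd (p n)"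
    by metis
  obtain r where r: "strict_mono r" "incseq ((\<lambda>n. fst (p n)) \<circ> r)"
    using wo_real_mono_subseq[OF assms(1), of "\<lambda>n. fst (p n)"] p by blast
  have dec: "s j < s i" if "i < j" for i j
    using lift_Suc_mono_less[of "\<lambda>n. - s n" i j] that s(2) by simp
  have "snd (p (r (Suc n))) < snd (p (r n))" for n
  proof -
    have "s (r (Suc n)) < s (r n)"
      using dec r(1) by (simp add: strict_mono_def)
    moreover have "fst (p (r n)) \<le> fst (p (r (Suc n)))"
      using incseqD[OF r(2), of n "Suc n"] by simp
    ultimately show ?thesis using p[of "r n"] p[of "r (Suc n)"] by linarith
  qed
  then show False
    using wo_real_no_descending[OF assms(2), of "\<lambda>n. snd (p (r n))"] p by blast
qed

lemma finite_wo_real_fibre: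
  fixes A B :: "real set"
  assumes "wfp_on A (<)" "wfp_on B (<)"
  shows "finite {a. a \<in> A \<and> c - a \<in> B}"
proof (rule ccontr)
  assume "infinite {a. a \<in> A \<and> c - a \<in> B}"
  then obtain s :: "nat \<Rightarrow> real" where s: "inj s" "range s \<subseteq> {a. a \<in> A \<and> c - a \<in> B}"
    using infinite_countable_subset by blast
  obtain r where r: "strict_mono r" "incseq (s \<circ> r)"
    using wo_real_mono_subseq[OF assms(1), of s] s(2) by blast
  have "s (r n) < s (r (Suc n))" for n
  proof -
    have "r n \<noteq> r (Suc n)" using r(1) by (metis n_not_Suc_n strict_mono_eq)
    then have "s (r n) \<noteq> s (r (Suc n))" using s(1) by (simp add: inj_eq)
    with incseqD[OF r(2), of n "Suc n"] show ?thesis by simp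
  qed
  then have "c - s (r (Suc n)) < c - s (r n)" for n
    by simp
  moreover have "c - s (r n) \<in> B" for n
    using s(2) by blast
  ultimately show False
    by (rule wo_real_no_descending[OF assms(2), rotated])
qed


section \<open>Generalized Puiseux series\<close>

text \<open>
  An element is its family of coefficients: \<^term>\<open>f k\<close> is the coefficient of \<open>t\<^sup>k\<close>, and the set
  of negated exponents is well ordered, so that there is a \<^emph>\<open>largest\<close> exponent. The real field
  \<open>\<real>{t}\<close> is \<open>real puiseux\<close>. The field \<open>\<complex>{t}\<close> is \<open>complex puiseux\<close>; that its elements are exactly
  the \<open>x + iy\<close> with \<open>x, y\<close> in \<open>\<real>{t}\<close>, uniquely so, is shown below.
\<close>

typedef (overloaded) 'a puiseux =
  "{f :: real \<Rightarrow> 'a::zero. wfp_on {k. f (- k) \<noteq> 0} (<)}"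
  morphisms pcoeff Abs_puiseux
  by (rule exI[of _ "\<lambda>_. 0"]) (simp add: wo_real_iff_min)

setup_lifting type_definition_puiseux

lemma puiseux_eqI: "(\<And>k. pcoeff x k = pcoeff y k) \<Longrightarrow> x = y"
  by (simp add: pcoeff_inject[symmetric] fun_eq_iff)

lemma wo_pcoeff: "wfp_on {k. pcoeff x (- k) \<noteq> 0} (<)"
  using pcoeff[of x] by simp

lemma wo_support_map:
  assumes "wfp_on {k::real. f (- k) \<noteq> 0} (<)" "g 0 = 0"
  shows "wfp_on {k. g (f (- k)) \<noteq> 0} (<)"
  by (rule wfp_on_subset[OF assms(1)]) (use assms(2) in auto)

lemma wo_support_add:
  fixes f g :: "real \<Rightarrow> 'a::monoid_add"
  assumes "wfp_on {k. f (- k) \<noteq> 0} (<)" "wfp_on {k. g (- k) \<noteq> 0} (<)"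
  shows "wfp_on {k. f (- k) + g (- k) \<noteq> 0} (<)"
  by (rule wfp_on_subset[OF wo_real_union[OF assms]]) auto

lemma wo_support_single: "wfp_on {k::real. (if - k = e then c else 0) \<noteq> 0} (<)"
proof -
  have "wfp_on {- e} (<)" by (simp add: wfp_on_def)
  then show ?thesis by (rule wfp_on_subset) (auto split: if_splits)
qed

lemma finite_support_fibre:
  fixes f g :: "real \<Rightarrow> 'a::zero"
  assumes "wfp_on {k. f (- k) \<noteq> 0} (<)" "wfp_on {k. g (- k) \<noteq> 0} (<)"
  shows "finite {i. f i \<noteq> 0 \<and> g (k - i) \<noteq> 0}"
proof -
  let ?S = "{a. a \<in> {k. f (- k) \<noteq> 0} \<and> - k - a \<in> {k. g (- k) \<noteq> 0}}"
  have "{i. f i \<noteq> 0 \<and> g (k - i) \<noteq> 0} \<subseteq> uminus ` ?S"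
  proof
    fix i assume "i \<in> {i. f i \<noteq> 0 \<and> g (k - i) \<noteq> 0}"
    then show "i \<in> uminus ` ?S" by (intro image_eqI[of _ _ "- i"]) simp_all
  qed
  moreover have "finite (uminus ` ?S)"
    using finite_wo_real_fibre[OF assms, of "- k"] by (rule finite_imageI)
  ultimately show ?thesis by (rule finite_subset)
qed

lemma wo_support_mult:
  fixes f g :: "real \<Rightarrow> 'a::semiring_0"
  assumes "wfp_on {k. f (- k) \<noteq> 0} (<)" "wfp_on {k. g (- k) \<noteq> 0} (<)"
  shows "wfp_on {k. (\<Sum>i | f i \<noteq> 0 \<and> g (- k - i) \<noteq> 0. f i * g (- k - i)) \<noteq> 0} (<)"
proof (rule wfp_on_subset[OF wo_real_sums[OF assms]], rule subsetI)
  fix k assume "k \<in> {k. (\<Sum>i | f i \<noteq> 0 \<and> g (- k - i) \<noteq> 0. f i * g (- k - i)) \<noteq> 0}"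
  then obtain i where "f i \<noteq> 0" "g (- k - i) \<noteq> 0"
    by (auto elim: sum.not_neutral_contains_not_neutral)
  moreover have "- (k + i) = - k - i" by simp
  ultimately have "k = - i + (k + i) \<and> - i \<in> {k. f (- k) \<noteq> 0} \<and> k + i \<in> {k. g (- k) \<noteq> 0}"
    by (simp only: mem_Collect_eq minus_minus) simp
  then show "k \<in> {a + b | a b. a \<in> {k. f (- k) \<noteq> 0} \<and> b \<in> {k. g (- k) \<noteq> 0}}"
    by blast
qed

lift_definition pmono :: "'a::zero \<Rightarrow> real \<Rightarrow> 'a puiseux"
  is "\<lambda>c e k. if k = e then c else 0"
  by (rule wo_support_single)

abbreviation pconst :: "'a::zero \<Rightarrow> 'a puiseux"
  where "pconst c \<equiv> pmono c 0"

instantiation puiseux :: (comm_ring_1) comm_ring_1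
begin

lift_definition zero_puiseux :: "'a puiseux" is "\<lambda>_. 0"
  by (simp add: wo_real_iff_min)

lift_definition one_puiseux :: "'a puiseux" is "\<lambda>k. if k = 0 then 1 else 0"
  by (rule wo_support_single)

lift_definition plus_puiseux :: "'a puiseux \<Rightarrow> 'a puiseux \<Rightarrow> 'a puiseux"
  is "\<lambda>f g k. f k + g k"
  by (rule wo_support_add)

lift_definition uminus_puiseux :: "'a puiseux \<Rightarrow> 'a puiseux" is "\<lambda>f k. - f k"
  by simp

definition minus_puiseux :: "'a puiseux \<Rightarrow> 'a puiseux \<Rightarrow> 'a puiseux"
  where "minus_puiseux x y = x + - y"

lift_definition times_puiseux :: "'a puiseux \<Rightarrow> 'a puiseux \<Rightarrow> 'a puiseux"
  is "\<lambda>f g k. \<Sum>i | f i \<noteq> 0 \<and> g (k - i) \<noteq> 0. f i * g (k - i)"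
  by (rule wo_support_mult)

lemma pcoeff_times_superset:
  fixes x y :: "'a puiseux"
  assumes "finite S" "{i. pcoeff x i \<noteq> 0 \<and> pcoeff y (k - i) \<noteq> 0} \<subseteq> S"
  shows "pcoeff (x * y) k = (\<Sum>i\<in>S. pcoeff x i * pcoeff y (k - i))"
  unfolding times_puiseux.rep_eq
  by (rule sum.mono_neutral_left[OF assms]) auto

lemma finite_pcoeff_fibre:
  fixes x y :: "'a puiseux"
  shows "finite {i. pcoeff x i \<noteq> 0 \<and> pcoeff y (k - i) \<noteq> 0}"
  by (rule finite_support_fibre[OF wo_pcoeff wo_pcoeff])

lemma puiseux_mult_commute: "x * y = y * x" for x y :: "'a puiseux"
proof (rule puiseux_eqI)
  fix k
  show "pcoeff (x * y) k = pcoeff (y * x) k"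
    unfolding times_puiseux.rep_eq
    by (rule sum.reindex_bij_witness[of _ "\<lambda>i. k - i" "\<lambda>i. k - i"]) (auto simp: mult.commute)
qed

lemma puiseux_distrib: "(x + y) * z = x * z + y * z" for x y z :: "'a puiseux"
proof (rule puiseux_eqI)
  fix k
  let ?S = "{i. pcoeff x i \<noteq> 0 \<and> pcoeff z (k - i) \<noteq> 0} \<union> {i. pcoeff y i \<noteq> 0 \<and> pcoeff z (k - i) \<noteq> 0}"
  have fin: "finite ?S" using finite_pcoeff_fibre by blast
  have "pcoeff ((x + y) * z) k = (\<Sum>i\<in>?S. pcoeff (x + y) i * pcoeff z (k - i))"
    by (rule pcoeff_times_superset[OF fin]) (auto simp: plus_puiseux.rep_eq)
  moreover have "pcoeff (x * z) k = (\<Sum>i\<in>?S. pcoeff x i * pcoeff z (k - i))"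
    by (rule pcoeff_times_superset[OF fin]) auto
  moreover have "pcoeff (y * z) k = (\<Sum>i\<in>?S. pcoeff y i * pcoeff z (k - i))"
    by (rule pcoeff_times_superset[OF fin]) auto
  ultimately show "pcoeff ((x + y) * z) k = pcoeff (x * z + y * z) k"
    by (simp add: plus_puiseux.rep_eq distrib_right sum.distrib)
qed

lemma puiseux_mult_triple:
  fixes x y z :: "'a puiseux"
  shows "pcoeff (x * y * z) k =
    (\<Sum>(i, j) | pcoeff x i \<noteq> 0 \<and> pcoeff y j \<noteq> 0 \<and> pcoeff z (k - i - j) \<noteq> 0.
       pcoeff x i * pcoeff y j * pcoeff z (k - i - j))"
proof -
  let ?A = "\<lambda>x::'a puiseux. {k. pcoeff x (- k) \<noteq> 0}"
  let ?T = "{a + b | a b. a \<in> ?A x \<and> b \<in> ?A y}"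
  let ?M = "uminus ` {a. a \<in> ?T \<and> - k - a \<in> ?A z}"
  let ?F = "\<lambda>m. {i. pcoeff x i \<noteq> 0 \<and> pcoeff y (m - i) \<noteq> 0}"
  have finM: "finite ?M"
    using finite_wo_real_fibre[OF wo_real_sums[OF wo_pcoeff wo_pcoeff] wo_pcoeff] by blast
  have memM: "m \<in> ?M \<longleftrightarrow> ?F m \<noteq> {} \<and> pcoeff z (k - m) \<noteq> 0" for m
  proof
    assume "m \<in> ?M"
    then obtain c where c: "m = - c" "c \<in> ?T" "- k - c \<in> ?A z" by blast
    from c(2) obtain a b where ab: "c = a + b" "a \<in> ?A x" "b \<in> ?A y" by blast
    have "- (- k - c) = k - m" using c(1) by simp
    with c ab have *: "m = - (a + b)" "pcoeff x (- a) \<noteq> 0" "pcoeff y (- b) \<noteq> 0"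
        "pcoeff z (k - m) \<noteq> 0"
      by (simp_all only: mem_Collect_eq not_False_eq_True)
    then have "- a \<in> ?F m" by simp
    with * show "?F m \<noteq> {} \<and> pcoeff z (k - m) \<noteq> 0" by blast
  next
    assume "?F m \<noteq> {} \<and> pcoeff z (k - m) \<noteq> 0"
    then obtain i where i: "pcoeff x i \<noteq> 0" "pcoeff y (m - i) \<noteq> 0" "pcoeff z (k - m) \<noteq> 0"
      by blast
    then have "- m = - i + (i - m) \<and> - i \<in> ?A x \<and> i - m \<in> ?A y" by simp
    then have "- m \<in> ?T" by blast
    with i(3) have "- m \<in> {a. a \<in> ?T \<and> - k - a \<in> ?A z}" by simp
    then show "m \<in> ?M" by (rule image_eqI[rotated]) simp
  qed
  have M_eq: "?M = {m. ?F m \<noteq> {} \<and> pcoeff z (k - m) \<noteq> 0}"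
    by (rule set_eqI, unfold mem_Collect_eq, rule memM[unfolded mem_Collect_eq])
  have "pcoeff (x * y * z) k = (\<Sum>m\<in>?M. pcoeff (x * y) m * pcoeff z (k - m))"
  proof (rule pcoeff_times_superset[OF finM], rule subsetI)
    fix m assume m: "m \<in> {i. pcoeff (x * y) i \<noteq> 0 \<and> pcoeff z (k - i) \<noteq> 0}"
    then have "(\<Sum>i\<in>?F m. pcoeff x i * pcoeff y (m - i)) \<noteq> 0" by (simp add: times_puiseux.rep_eq)
    then have "?F m \<noteq> {}" by (metis sum.empty)
    with m show "m \<in> ?M" unfolding memM by simp
  qed
  also have "\<dots> = (\<Sum>m\<in>?M. \<Sum>i\<in>?F m. pcoeff x i * pcoeff y (m - i) * pcoeff z (k - m))"
    by (simp add: times_puiseux.rep_eq sum_distrib_right)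
  also have "\<dots> = (\<Sum>(m, i)\<in>Sigma ?M ?F. pcoeff x i * pcoeff y (m - i) * pcoeff z (k - m))"
    by (rule sum.Sigma) (use finM finite_pcoeff_fibre in auto)
  also have "\<dots> = (\<Sum>(i, j) | pcoeff x i \<noteq> 0 \<and> pcoeff y j \<noteq> 0 \<and> pcoeff z (k - i - j) \<noteq> 0.
       pcoeff x i * pcoeff y j * pcoeff z (k - i - j))"
    unfolding M_eq
    by (rule sum.reindex_bij_witness[of _ "\<lambda>(i, j). (i + j, i)" "\<lambda>(m, i). (i, m - i)"])
      (force simp: diff_diff_eq)+
  finally show ?thesis .
qed

lemma puiseux_mult_assoc: "x * y * z = x * (y * z)" for x y z :: "'a puiseux"
proof (rule puiseux_eqI)
  fix k
  have "pcoeff (x * (y * z)) k = pcoeff (y * z * x) k" by (simp add: puiseux_mult_commute)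
  also have "\<dots> = pcoeff (x * y * z) k"
    unfolding puiseux_mult_triple
    by (rule sum.reindex_bij_witness[of _ "\<lambda>(i, j). (j, k - i - j)" "\<lambda>(i, j). (k - i - j, i)"])
      (auto simp: algebra_simps)
  finally show "pcoeff (x * y * z) k = pcoeff (x * (y * z)) k" by simp
qed

lemma pcoeff_pmono_times:
  fixes x :: "'a puiseux"
  shows "pcoeff (pmono c e * x) k = c * pcoeff x (k - e)"
  by (subst pcoeff_times_superset[of "{e}"]) (auto simp: pmono.rep_eq split: if_splits)

lemma puiseux_one_mult: "1 * x = x" for x :: "'a puiseux"
proof (rule puiseux_eqI)
  fix k
  have "pcoeff (1 * x) k = (\<Sum>i\<in>{0}. pcoeff 1 i * pcoeff x (k - i))"
    by (rule pcoeff_times_superset) (auto simp: one_puiseux.rep_eq split: if_splits)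
  then show "pcoeff (1 * x) k = pcoeff x k"
    by (simp add: one_puiseux.rep_eq)
qed

instance
proof
  fix x y z :: "'a puiseux"
  show "x + y + z = x + (y + z)" by transfer (simp add: add.assoc)
  show "x + y = y + x" by transfer (simp add: add.commute)
  show "0 + x = x" by transfer simp
  show "- x + x = 0" by transfer simp
  show "x - y = x + - y" by (simp add: minus_puiseux_def)
  show "x * y * z = x * (y * z)" by (rule puiseux_mult_assoc)
  show "x * y = y * x" by (rule puiseux_mult_commute)
  show "(x + y) * z = x * z + y * z" by (rule puiseux_distrib)
  show "1 * x = x" by (rule puiseux_one_mult)
  show "(0 :: 'a puiseux) \<noteq> 1" by transfer (metis zero_neq_one)
qed

end

lift_definition pRe :: "complex puiseux \<Rightarrow> real puiseux" is "\<lambda>f k. Re (f k)"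
  by (rule wo_support_map) simp_all

lift_definition pIm :: "complex puiseux \<Rightarrow> real puiseux" is "\<lambda>f k. Im (f k)"
  by (rule wo_support_map) simp_all

lift_definition pcomplex_of_real :: "real puiseux \<Rightarrow> complex puiseux"
  is "\<lambda>f k. complex_of_real (f k)"
  by (rule wo_support_map) simp_all

lemma puiseux_Re_Im:
  "pcomplex_of_real (pRe z) + pconst \<i> * pcomplex_of_real (pIm z) = z"
  "pRe (pcomplex_of_real x + pconst \<i> * pcomplex_of_real y) = x"
  "pIm (pcomplex_of_real x + pconst \<i> * pcomplex_of_real y) = y"
  by (rule puiseux_eqI, simp add: pRe.rep_eq pIm.rep_eq pcomplex_of_real.rep_eq
      plus_puiseux.rep_eq pcoeff_pmono_times complex_eq_iff)+

definition leading_exponent :: "'a::zero puiseux \<Rightarrow> real"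
  where "leading_exponent x = (GREATEST k. pcoeff x k \<noteq> 0)"

definition leading_coeff :: "'a::zero puiseux \<Rightarrow> 'a"
  where "leading_coeff x = pcoeff x (leading_exponent x)"

definition valuation :: "'a::comm_ring_1 puiseux \<Rightarrow> ereal"
  where "valuation x = (if x = 0 then - \<infinity> else ereal (leading_exponent x))"

lemma leading_exponent_props:
  fixes x :: "'a::comm_ring_1 puiseux"
  assumes "x \<noteq> 0"
  shows "pcoeff x (leading_exponent x) \<noteq> 0"
    and "\<And>k. pcoeff x k \<noteq> 0 \<Longrightarrow> k \<le> leading_exponent x"
proof -
  obtain k0 where k0: "pcoeff x k0 \<noteq> 0"
    using assms puiseux_eqI[of x 0] by (auto simp: zero_puiseux.rep_eq)
  have ne: "{k. pcoeff x (- k) \<noteq> 0} \<noteq> {}"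
    using k0 by (metis (mono_tags, lifting) empty_iff mem_Collect_eq minus_minus)
  obtain m where m: "m \<in> {k. pcoeff x (- k) \<noteq> 0}" "\<And>b. b \<in> {k. pcoeff x (- k) \<noteq> 0} \<Longrightarrow> m \<le> b"
    using wo_real_minE[OF wo_pcoeff subset_refl ne] by blast
  have max: "k \<le> - m" if "pcoeff x k \<noteq> 0" for k
    using m(2)[of "- k"] that by simp
  then have eq: "leading_exponent x = - m"
    unfolding leading_exponent_def using m(1) by (intro Greatest_equality) auto
  show "pcoeff x (leading_exponent x) \<noteq> 0" using m(1) eq by simp
  show "\<And>k. pcoeff x k \<noteq> 0 \<Longrightarrow> k \<le> leading_exponent x" using max eq by simp
qed

definition puiseux_pos :: "real puiseux \<Rightarrow> bool"
  where "puiseux_pos x \<longleftrightarrow> x \<noteq> 0 \<and> leading_coeff x > 0"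


section \<open>Polynomials with the half-plane property\<close>

text \<open>
  The polynomial ring in \<open>n = CARD('n)\<close> variables is the monoid algebra of \<open>\<nat>\<^sup>n\<close>: a finitely
  supported map from exponent vectors to coefficients.
\<close>

type_synonym ('a, 'n) mpol = "(nat ^ 'n) \<Rightarrow>\<^sub>0 'a"

definition mpol_eval :: "('a::comm_ring_1, 'n::finite) mpol \<Rightarrow> 'a ^ 'n \<Rightarrow> 'a"
  where "mpol_eval P z = (\<Sum>\<alpha>\<in>Poly_Mapping.keys P. Poly_Mapping.lookup P \<alpha> * (\<Prod>j\<in>UNIV. (z $ j) ^ (\<alpha> $ j)))"

definition half_plane :: "real \<Rightarrow> complex puiseux set"
  where "half_plane \<theta> = {z. puiseux_pos (pIm (pconst (exp (\<i> * complex_of_real \<theta>)) * z))}"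

definition half_plane_stable :: "real \<Rightarrow> (complex puiseux, 'n::finite) mpol \<Rightarrow> bool"
  where "half_plane_stable \<theta> P \<longleftrightarrow> (\<forall>z. (\<forall>j. z $ j \<in> half_plane \<theta>) \<longrightarrow> mpol_eval P z \<noteq> 0)"

definition half_plane_property :: "(complex puiseux, 'n::finite) mpol \<Rightarrow> bool"
  where "half_plane_property P \<longleftrightarrow> (\<exists>\<theta>. half_plane_stable \<theta> P)"

text \<open>Supports and tropicalizations live on \<open>\<int>\<^sup>n\<close>, which contains the exponent vectors in \<open>\<nat>\<^sup>n\<close>.\<close>

definition supp :: "('a::zero, 'n::finite) mpol \<Rightarrow> (int ^ 'n) set"
  where "supp P = (\<lambda>\<alpha>. \<chi> i. int (\<alpha> $ i)) ` {\<alpha>. Poly_Mapping.lookup P \<alpha> \<noteq> 0}"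

text \<open>Only the values on \<^term>\<open>supp P\<close> are meaningful; there the valuation is finite.\<close>

definition trop :: "('a::comm_ring_1 puiseux, 'n::finite) mpol \<Rightarrow> int ^ 'n \<Rightarrow> real"
  where "trop P \<alpha> = real_of_ereal (valuation (Poly_Mapping.lookup P (\<chi> i. nat (\<alpha> $ i))))"


section \<open>Steps and M-concave functions\<close>

definition l1 :: "int ^ 'n::finite \<Rightarrow> int"
  where "l1 \<alpha> = (\<Sum>i\<in>UNIV. \<bar>\<alpha> $ i\<bar>)"

definition constant_parity :: "(int ^ 'n::finite) set \<Rightarrow> bool"
  where "constant_parity A \<longleftrightarrow> (\<forall>\<alpha>\<in>A. \<forall>\<beta>\<in>A. even (l1 \<alpha> - l1 \<beta>))"

definition is_step :: "int ^ 'n::finite \<Rightarrow> int ^ 'n \<Rightarrow> int ^ 'n \<Rightarrow> bool"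
  where "is_step \<alpha> s \<beta> \<longleftrightarrow> l1 s = 1 \<and> l1 (\<alpha> + s - \<beta>) = l1 (\<alpha> - \<beta>) - 1"

text \<open>\<^term>\<open>M_concave J f\<close> concerns the restriction of \<^term>\<open>f\<close> to its domain \<^term>\<open>J\<close>.\<close>

definition M_concave :: "(int ^ 'n::finite) set \<Rightarrow> (int ^ 'n \<Rightarrow> real) \<Rightarrow> bool"
  where "M_concave J f \<longleftrightarrow>
    (\<forall>\<alpha>\<in>J. \<forall>\<beta>\<in>J. \<forall>s. is_step \<alpha> s \<beta> \<longrightarrow>
      (\<exists>t. is_step (\<alpha> + s) t \<beta> \<and> \<alpha> + s + t \<in> J \<and> \<beta> - s - t \<in> J \<and>
           f \<alpha> + f \<beta> \<le> f (\<alpha> + s + t) + f (\<beta> - s - t)))"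

end

theory Submission
  imports Defs "HOL-Computational_Algebra.Fundamental_Theorem_Algebra"
begin

text \<open>
  The field \<open>\<complex>{t}\<close> is algebraically closed, so the theorems of Gauss--Lucas, Laguerre and
  Grace--Walsh--Szego hold over it. Polarizing \<open>P\<close> and replacing some variables \<open>z\<close> by \<open>- 1 / z\<close>
  reduces the claim to a stable multiaffine polynomial \<open>\<Sum>\<^sub>S c(S) z\<^sup>S\<close> supported on even sets, with
  \<open>\<alpha>\<close> the empty set, \<open>\<beta>\<close> a set \<open>B\<close> and the step an element \<open>e \<in> B\<close>. Put \<open>w\<close> for \<open>z\<^sub>e\<close> and \<open>\<lambda>\<^sub>f x\<close> for
  the other variables, with \<open>\<lambda>\<^sub>f\<close> a power of \<open>t\<close>. This gives a stable pencil \<open>A(x) + w Q(x)\<close>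
  with \<open>A\<close> even and \<open>Q\<close> odd, and a root of a suitable member of it shows
  \<open>\<nu>(A\<^sub>0) + \<nu>(Q\<^sub>d) \<le> \<nu>(A\<^sub>d\<^sub>-\<^sub>1) + \<nu>(Q\<^sub>1)\<close> for \<open>d = |B| - 1\<close>. If every exchange partner \<open>f\<close> failed,
  the exponents of the \<open>\<lambda>\<^sub>f\<close> could be chosen such that this inequality is violated.
\<close>

section \<open>Bounds on exponents and initial forms\<close>

text \<open>The coefficients are complex, so no argument on the signs of coefficients is available.
  Every inequality between valuations comes from one source: when elements with nonnegative
  imaginary parts are added, the imaginary part of the sum has at least the exponent of the
  imaginary part of each nonreal summand. Applied to the roots of a polynomial and to their
  reciprocals, Vieta's formulas turn this into statements about the two coefficients at either end,
  which is why the pencil inequality involves only the indices 0, 1, d - 1 and d. A root of exponent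
  N contributes N to one bound and -N to the other, so the sum of the two bounds is free of N.
  Constant parity enters through the symmetry (x, w) -> (-x, -w) of the zeros of the pencil, which
  forces the parameter w into the correct half-plane. Polarization makes P affine in the
  distinguished variable w and turns unit steps of both signs into a single operation, toggling an
  element of a set.\<close>

definition exps_le :: "'a::zero puiseux \<Rightarrow> real \<Rightarrow> bool"
  where "exps_le x k \<longleftrightarrow> (\<forall>j>k. pcoeff x j = 0)"

lemma exps_leD: "exps_le x k \<Longrightarrow> k < j \<Longrightarrow> pcoeff x j = 0"
  by (simp add: exps_le_def)

lemma exps_le_mono: "exps_le x k \<Longrightarrow> k \<le> l \<Longrightarrow> exps_le x l"
  by (auto simp: exps_le_def)

lemma exps_le_0 [simp]: "exps_le (0 :: 'a::comm_ring_1 puiseux) k"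
  by (simp add: exps_le_def zero_puiseux.rep_eq)

lemma exps_le_add: "exps_le x k \<Longrightarrow> exps_le y k \<Longrightarrow> exps_le (x + y) k"
  for x y :: "'a::comm_ring_1 puiseux"
  by (simp add: exps_le_def plus_puiseux.rep_eq)

lemma exps_le_uminus [simp]: "exps_le (- x) k \<longleftrightarrow> exps_le x k"
  for x :: "'a::comm_ring_1 puiseux"
  by (simp add: exps_le_def uminus_puiseux.rep_eq)

lemma pcoeff_minus: "pcoeff (x - y) k = pcoeff x k - pcoeff y k"
  for x y :: "'a::comm_ring_1 puiseux"
  by (simp add: diff_conv_add_uminus plus_puiseux.rep_eq uminus_puiseux.rep_eq
      del: add_uminus_conv_diff)

lemma exps_le_sum: "(\<And>i. i \<in> I \<Longrightarrow> exps_le (f i) k) \<Longrightarrow> exps_le (sum f I) k"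
  for f :: "'i \<Rightarrow> 'a::comm_ring_1 puiseux"
  by (induction I rule: infinite_finite_induct) (auto intro: exps_le_add)

lemma pcoeff_sum: "pcoeff (sum f I) k = (\<Sum>i\<in>I. pcoeff (f i) k)"
  for f :: "'i \<Rightarrow> 'a::comm_ring_1 puiseux"
  by (induction I rule: infinite_finite_induct)
     (auto simp: zero_puiseux.rep_eq plus_puiseux.rep_eq)

text \<open>Only the index k contributes at \<open>k + l\<close>: a larger index meets x above its
  bound, a smaller one meets y above its bound. Neither bound has to be attained, so the top
  coefficient may vanish; initial forms rely on this.\<close>

lemma mult_exps_le:
  fixes x y :: "'a::comm_ring_1 puiseux"
  assumes "exps_le x k" "exps_le y l"
  shows exps_le_mult: "exps_le (x * y) (k + l)"
    and pcoeff_mult_top: "pcoeff (x * y) (k + l) = pcoeff x k * pcoeff y l"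
proof -
  show "exps_le (x * y) (k + l)"
    unfolding exps_le_def
  proof (intro allI impI)
    fix j assume j: "k + l < j"
    have "{i. pcoeff x i \<noteq> 0 \<and> pcoeff y (j - i) \<noteq> 0} = {}"
    proof -
      have "pcoeff x i = 0 \<or> pcoeff y (j - i) = 0" for i
        using assms j by (cases "k < i") (auto simp: exps_le_def)
      then show ?thesis by blast
    qed
    then show "pcoeff (x * y) j = 0" by (simp only: times_puiseux.rep_eq sum.empty)
  qed
  have "pcoeff x i = 0 \<or> pcoeff y (k + l - i) = 0" if "i \<noteq> k" for i
    using assms that by (cases "k < i") (auto simp: exps_le_def)
  then have "{i. pcoeff x i \<noteq> 0 \<and> pcoeff y (k + l - i) \<noteq> 0} \<subseteq> {k}" by blast
  then show "pcoeff (x * y) (k + l) = pcoeff x k * pcoeff y l"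
    by (subst pcoeff_times_superset[of "{k}"]) auto
qed

lemma pcoeff_leading_exponent: "x \<noteq> 0 \<Longrightarrow> pcoeff x (leading_exponent x) \<noteq> 0"
  for x :: "'a::comm_ring_1 puiseux"
  by (rule leading_exponent_props)

lemma exps_le_leading_exponent: "x \<noteq> 0 \<Longrightarrow> exps_le x (leading_exponent x)"
  for x :: "'a::comm_ring_1 puiseux"
  using leading_exponent_props(2)[of x] by (force simp: exps_le_def)

text \<open>As \<open>leading_exponent 0\<close> is an unspecified real, exponents of sums and
  products are found by a bound that also makes sense for 0, together with a nonzero coefficient at
  that bound.\<close>

lemma leading_exponent_eqI:
  fixes x :: "'a::comm_ring_1 puiseux"
  assumes "exps_le x k" "pcoeff x k \<noteq> 0"
  shows "x \<noteq> 0" "leading_exponent x = k" "leading_coeff x = pcoeff x k"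
proof -
  show nz: "x \<noteq> 0" using assms(2) by (auto simp: zero_puiseux.rep_eq)
  show "leading_exponent x = k"
    using assms leading_exponent_props[OF nz] unfolding exps_le_def
    by (metis leD linorder_neqE_linordered_idom not_less)
  then show "leading_coeff x = pcoeff x k" by (simp add: leading_coeff_def)
qed

lemma exps_le_iff: "x \<noteq> 0 \<Longrightarrow> exps_le x k \<longleftrightarrow> leading_exponent x \<le> k"
  for x :: "'a::comm_ring_1 puiseux"
  using exps_le_mono[OF exps_le_leading_exponent] pcoeff_leading_exponent
  by (metis exps_leD not_le)

lemma leading_coeff_nz: "x \<noteq> 0 \<Longrightarrow> leading_coeff x \<noteq> 0"
  for x :: "'a::comm_ring_1 puiseux"
  by (simp add: leading_coeff_def pcoeff_leading_exponent)

lemma leading_coeff_0 [simp]: "leading_coeff (0 :: 'a::comm_ring_1 puiseux) = 0"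
  by (simp add: leading_coeff_def zero_puiseux.rep_eq)

lemma leading_mult:
  fixes x y :: "'a::idom puiseux"
  assumes "x \<noteq> 0" "y \<noteq> 0"
  shows leading_mult_nz: "x * y \<noteq> 0"
    and leading_exponent_mult: "leading_exponent (x * y) = leading_exponent x + leading_exponent y"
    and leading_coeff_mult': "leading_coeff (x * y) = leading_coeff x * leading_coeff y"
proof -
  note le = exps_le_leading_exponent[OF assms(1)] exps_le_leading_exponent[OF assms(2)]
  have nz: "pcoeff (x * y) (leading_exponent x + leading_exponent y) \<noteq> 0"
    using pcoeff_mult_top[OF le] assms pcoeff_leading_exponent by (metis mult_eq_0_iff)
  note * = leading_exponent_eqI[OF exps_le_mult[OF le] nz]
  show "x * y \<noteq> 0" "leading_exponent (x * y) = leading_exponent x + leading_exponent y"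
    by (rule *)+
  show "leading_coeff (x * y) = leading_coeff x * leading_coeff y"
    unfolding *(3) by (simp add: pcoeff_mult_top[OF le] leading_coeff_def)
qed

instance puiseux :: (idom) idom
  by standard (rule leading_mult_nz)

lemma leading_coeff_mult: "leading_coeff (x * y) = leading_coeff x * leading_coeff y"
  for x y :: "'a::idom puiseux"
  by (cases "x = 0 \<or> y = 0") (auto simp: leading_coeff_mult')

lemma leading_exponent_uminus [simp]: "leading_exponent (- x) = leading_exponent x"
  for x :: "'a::comm_ring_1 puiseux"
  by (simp add: leading_exponent_def uminus_puiseux.rep_eq)

lemma leading_coeff_uminus [simp]: "leading_coeff (- x) = - leading_coeff x"
  for x :: "'a::comm_ring_1 puiseux"
  by (simp add: leading_coeff_def uminus_puiseux.rep_eq)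

lemma exps_le_pmono [simp]: "exps_le (pmono c e) e"
  by (simp add: exps_le_def pmono.rep_eq)

lemma pcoeff_pmono [simp]: "pcoeff (pmono c e) k = (if k = e then c else 0)"
  by (simp add: pmono.rep_eq)

lemma pmono_eq_0_iff [simp]: "pmono c e = 0 \<longleftrightarrow> c = 0" for c :: "'a::comm_ring_1"
proof
  assume "pmono c e = 0"
  then have "pcoeff (pmono c e) e = pcoeff 0 e" by simp
  then show "c = 0" by (simp add: zero_puiseux.rep_eq)
next
  assume "c = 0" then show "pmono c e = 0" by (intro puiseux_eqI) (simp add: zero_puiseux.rep_eq)
qed

lemma leading_exponent_pmono [simp]: "c \<noteq> 0 \<Longrightarrow> leading_exponent (pmono c e) = e"
  for c :: "'a::comm_ring_1"
  by (rule leading_exponent_eqI(2)) auto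

lemma leading_coeff_pmono [simp]: "leading_coeff (pmono c e) = c"
  for c :: "'a::comm_ring_1"
  by (cases "c = 0") (auto simp: leading_coeff_def pmono_eq_0_iff[THEN iffD2] zero_puiseux.rep_eq)

lemma pmono_mult: "pmono c e * pmono d f = pmono (c * d) (e + f)" for c d :: "'a::comm_ring_1"
  by (rule puiseux_eqI) (auto simp: pcoeff_pmono_times)

lemma pconst_1: "pconst 1 = (1 :: 'a::comm_ring_1 puiseux)"
  by (rule puiseux_eqI) (simp add: one_puiseux.rep_eq)

lemma pconst_add: "pconst (c + d) = pconst c + pconst d" for c d :: "'a::comm_ring_1"
  by (rule puiseux_eqI) (simp add: plus_puiseux.rep_eq)

lemma of_nat_puiseux: "of_nat n = (pconst (of_nat n) :: 'a::comm_ring_1 puiseux)"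
  by (induction n) (auto simp: pconst_add pconst_1)

lemma leading_exponent_of_nat [simp]:
  "n \<noteq> 0 \<Longrightarrow> leading_exponent (of_nat n :: 'a::{comm_ring_1,ring_char_0} puiseux) = 0"
  by (simp add: of_nat_puiseux)

text \<open>Characteristic 0 makes derivatives of nonconstant polynomials and the multiples
  \<open>of_nat k\<close> with k > 0 nonzero.\<close>

instance puiseux :: ("{comm_ring_1,ring_char_0}") ring_char_0
proof
  show "inj (of_nat :: nat \<Rightarrow> 'a puiseux)"
  proof (rule injI)
    fix m n :: nat assume "of_nat m = (of_nat n :: 'a puiseux)"
    then have "leading_coeff (pconst (of_nat m :: 'a)) = leading_coeff (pconst (of_nat n :: 'a))"
      by (simp only: of_nat_puiseux)
    then show "m = n" unfolding leading_coeff_pmono by simp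
  qed
qed

text \<open>In other words, \<open>t\<^sup>-\<^sup>V q(t\<^sup>\<rho> x)\<close> has coefficients in the valuation ring, and \<open>g\<close> is its reduction.\<close>

definition initial_form :: "real \<Rightarrow> real \<Rightarrow> 'a::comm_ring_1 puiseux poly \<Rightarrow> 'a poly \<Rightarrow> bool"
  where "initial_form \<rho> V q g \<longleftrightarrow>
    (\<forall>i. exps_le (coeff q i) (V - real i * \<rho>) \<and> coeff g i = pcoeff (coeff q i) (V - real i * \<rho>))"

lemma initial_form_0: "initial_form \<rho> V 0 g \<longleftrightarrow> g = 0"
  by (auto simp: initial_form_def zero_puiseux.rep_eq poly_eq_iff)

lemma initial_form_pCons:
  "initial_form \<rho> V (pCons a q) (pCons b g) \<longleftrightarrow>
    exps_le a V \<and> b = pcoeff a V \<and> initial_form \<rho> (V - \<rho>) q g" (is "?l \<longleftrightarrow> ?r")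
proof
  assume l: ?l
  have "exps_le (coeff q i) (V - \<rho> - real i * \<rho>) \<and> coeff g i = pcoeff (coeff q i) (V - \<rho> - real i * \<rho>)" for i
    using l[unfolded initial_form_def, rule_format, of "Suc i"] by (simp add: algebra_simps)
  moreover have "exps_le a V \<and> b = pcoeff a V"
    using l[unfolded initial_form_def, rule_format, of 0] by simp
  ultimately show ?r by (simp add: initial_form_def)
next
  assume r: ?r
  show ?l unfolding initial_form_def
  proof
    fix i
    show "exps_le (coeff (pCons a q) i) (V - real i * \<rho>) \<and>
       coeff (pCons b g) i = pcoeff (coeff (pCons a q) i) (V - real i * \<rho>)"
    proof (cases i)
      case 0 then show ?thesis using r by simp
    next
      case (Suc j)
      then show ?thesis using r by (simp add: initial_form_def algebra_simps)
    qed
  qed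
qed

lemma initial_form_add:
  "initial_form \<rho> V q g \<Longrightarrow> initial_form \<rho> V q' g' \<Longrightarrow> initial_form \<rho> V (q + q') (g + g')"
  by (auto simp: initial_form_def plus_puiseux.rep_eq intro: exps_le_add)

lemma initial_form_smult:
  "exps_le h \<sigma> \<Longrightarrow> initial_form \<rho> V q g \<Longrightarrow> initial_form \<rho> (\<sigma> + V) (smult h q) (smult (pcoeff h \<sigma>) g)"
  unfolding initial_form_def
  by (auto simp: add_diff_eq[symmetric] intro!: exps_le_mult pcoeff_mult_top[symmetric])

text \<open>Reduction respects sums and products, and t^(-\<rho>) h has the residue
  \<open>pcoeff h \<rho>\<close>. Horner's scheme splits the shifted polynomial into a constant, a
  multiple by h and a multiple by the variable.\<close>

lemma initial_form_shift:
  assumes "initial_form \<rho> V q g" "exps_le h \<rho>"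
  shows "initial_form \<rho> V (q \<circ>\<^sub>p [:h, 1:]) (g \<circ>\<^sub>p [:pcoeff h \<rho>, 1:])"
  using assms(1)
proof (induction q arbitrary: V g)
  case 0 then show ?case by (auto simp: initial_form_0)
next
  case (pCons a q)
  obtain b g' where g: "g = pCons b g'" by (cases g)
  from pCons.prems have *: "exps_le a V" "b = pcoeff a V" "initial_form \<rho> (V - \<rho>) q g'"
    by (auto simp: g initial_form_pCons)
  let ?q = "q \<circ>\<^sub>p [:h, 1:]" and ?g = "g' \<circ>\<^sub>p [:pcoeff h \<rho>, 1:]"
  have IH: "initial_form \<rho> (V - \<rho>) ?q ?g" by (rule pCons.IH[OF *(3)])
  have "initial_form \<rho> V (pCons a 0) (pCons b 0)"
    using * by (simp add: initial_form_pCons initial_form_0)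
  moreover have "initial_form \<rho> V (smult h ?q) (smult (pcoeff h \<rho>) ?g)"
    using initial_form_smult[OF assms(2) IH] by simp
  moreover have "initial_form \<rho> V (pCons 0 ?q) (pCons 0 ?g)"
    using IH by (simp add: initial_form_pCons zero_puiseux.rep_eq)
  ultimately show ?case
    by (auto simp: g pcompose_pCons intro!: initial_form_add)
qed


section \<open>Algebraic closedness\<close>

text \<open>Spherical completeness: C is a set of centres and \<open>\<rho>\<close> gives the radii.
  The common point takes its coefficient at k from any centre of radius below k, all of which agree
  there, and 0 if there is none. Its support is well ordered because above any of its exponents it
  coincides with a single centre.\<close>

lemma nested_balls_inhabited:
  fixes C :: "'a::comm_ring_1 puiseux set" and \<rho> :: "'a puiseux \<Rightarrow> real"
  assumes nested: "\<And>a b. a \<in> C \<Longrightarrow> b \<in> C \<Longrightarrow> exps_le (b - a) (max (\<rho> a) (\<rho> b))"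
  obtains x where "\<And>a. a \<in> C \<Longrightarrow> exps_le (x - a) (\<rho> a)"
proof -
  define f where "f k = (if \<exists>a\<in>C. \<rho> a < k then pcoeff (SOME a. a \<in> C \<and> \<rho> a < k) k else 0)" for k
  have f_eq: "f k = pcoeff a k" if a: "a \<in> C" "\<rho> a < k" for a k
  proof -
    define b where "b = (SOME a. a \<in> C \<and> \<rho> a < k)"
    have b: "b \<in> C \<and> \<rho> b < k" unfolding b_def by (rule someI[of _ a]) (use a in simp)
    have "pcoeff (b - a) k = 0"
      using exps_leD[OF nested[of a b], of k] a b by simp
    then show ?thesis using a by (auto simp: f_def b_def pcoeff_minus)
  qed
  have wo: "wfp_on {k. f (- k) \<noteq> 0} (<)"
    unfolding wo_real_iff_min
  proof (intro allI impI)
    fix B assume B: "B \<subseteq> {k. f (- k) \<noteq> 0}" "B \<noteq> {}"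
    then obtain b where b: "b \<in> B" "f (- b) \<noteq> 0" by blast
    then obtain a where a: "a \<in> C" "\<rho> a < - b" by (auto simp: f_def split: if_splits)
    have "{k \<in> B. k \<le> b} \<subseteq> {k. pcoeff a (- k) \<noteq> 0}"
    proof
      fix k assume k: "k \<in> {k \<in> B. k \<le> b}"
      then have "f (- k) = pcoeff a (- k)" using a by (intro f_eq) auto
      with k B(1) show "k \<in> {k. pcoeff a (- k) \<noteq> 0}" by auto
    qed
    moreover have "{k \<in> B. k \<le> b} \<noteq> {}" using b by blast
    ultimately obtain m where m: "m \<in> {k \<in> B. k \<le> b}" "\<And>k. k \<in> {k \<in> B. k \<le> b} \<Longrightarrow> m \<le> k"
      using wo_real_minE[OF wo_pcoeff[of a], of "{k \<in> B. k \<le> b}"] by metis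
    have "m \<le> k" if "k \<in> B" for k
      using m(1) m(2)[of k] that by (cases "k \<le> b") auto
    with m(1) show "\<exists>m\<in>B. \<forall>b\<in>B. m \<le> b" by blast
  qed
  then have coeff: "pcoeff (Abs_puiseux f) = f" by (intro Abs_puiseux_inverse) simp
  show thesis
  proof (rule that[of "Abs_puiseux f"])
    fix a assume "a \<in> C"
    then show "exps_le (Abs_puiseux f - a) (\<rho> a)"
      using f_eq by (auto simp: exps_le_def pcoeff_minus coeff)
  qed
qed

text \<open>The valuation of the smallest roots of \<open>q\<close>, read off the Newton polygon.\<close>

definition newton_slope :: "'a::comm_ring_1 puiseux poly \<Rightarrow> real"
  where "newton_slope q = Min ((\<lambda>i. (leading_exponent (coeff q 0) - leading_exponent (coeff q i)) / real i)
    ` {i. 0 < i \<and> coeff q i \<noteq> 0})"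

lemma finite_nonzero_coeffs: "finite {i. 0 < i \<and> coeff q i \<noteq> 0}"
  by (rule finite_subset[of _ "{..degree q}"]) (auto intro: le_degree)

lemma newton_slope_le:
  "0 < i \<Longrightarrow> coeff q i \<noteq> 0 \<Longrightarrow>
    newton_slope q \<le> (leading_exponent (coeff q 0) - leading_exponent (coeff q i)) / real i"
  unfolding newton_slope_def by (intro Min_le finite_imageI finite_nonzero_coeffs) auto

text \<open>The slope is a minimum, so every exponent lies on or below the line V - i \<rho>. The
  line is met at the minimizing index i > 0, which gives g a nonzero coefficient of positive
  index.\<close>

lemma initial_form_newton_slope:
  assumes q0: "coeff q 0 \<noteq> 0" and deg: "degree q > 0"
  obtains g where "initial_form (newton_slope q) (leading_exponent (coeff q 0)) q g" "degree g > 0"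
proof -
  define \<rho> V where "\<rho> = newton_slope q" and "V = leading_exponent (coeff q 0)"
  define g where "g = (\<Sum>i\<le>degree q. monom (pcoeff (coeff q i) (V - real i * \<rho>)) i)"
  have g: "coeff g i = pcoeff (coeff q i) (V - real i * \<rho>)" for i
    by (auto simp: g_def coeff_sum coeff_eq_0 zero_puiseux.rep_eq)
  have le: "exps_le (coeff q i) (V - real i * \<rho>)" for i
  proof (cases "coeff q i = 0 \<or> i = 0")
    case True
    then show ?thesis using q0 by (auto simp: V_def exps_le_leading_exponent)
  next
    case False
    then have "\<rho> * real i \<le> V - leading_exponent (coeff q i)"
      using newton_slope_le[of i q] by (simp add: \<rho>_def V_def pos_le_divide_eq)
    with False show ?thesis by (simp add: exps_le_iff algebra_simps)
  qed
  let ?I = "{i. 0 < i \<and> coeff q i \<noteq> 0}"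
  have "degree q \<in> ?I" using deg by auto
  then have "\<rho> \<in> (\<lambda>i. (V - leading_exponent (coeff q i)) / real i) ` ?I"
    unfolding \<rho>_def V_def newton_slope_def by (intro Min_in finite_imageI finite_nonzero_coeffs) auto
  then obtain i where i: "0 < i" "coeff q i \<noteq> 0" "\<rho> = (V - leading_exponent (coeff q i)) / real i"
    by auto
  then have "V - real i * \<rho> = leading_exponent (coeff q i)" by (simp add: field_simps)
  then have "coeff g i \<noteq> 0" using i(2) by (simp add: g pcoeff_leading_exponent)
  then have "degree g > 0" using i(1) by (meson le_degree less_le_trans)
  moreover have "initial_form \<rho> V q g" using g le by (auto simp: initial_form_def)
  ultimately show thesis using that by (simp add: \<rho>_def V_def)
qed

text \<open>Translation keeps the degree i of g, so coefficient i of the shifted polynomial still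
  has exponent exactly V - i \<rho>. Comparing it with the new constant term, whose exponent is at
  most V, bounds the new slope. If the residue of h is a root of g, the constant term drops strictly
  below V.\<close>

lemma newton_slope_shift:
  fixes q :: "'a::idom puiseux poly"
  assumes g: "initial_form \<rho> V q g" "degree g > 0" and h: "exps_le h \<rho>"
    and nz: "coeff (q \<circ>\<^sub>p [:h, 1:]) 0 \<noteq> 0"
  shows "newton_slope (q \<circ>\<^sub>p [:h, 1:]) \<le> \<rho>"
    and "poly g (pcoeff h \<rho>) = 0 \<Longrightarrow> newton_slope (q \<circ>\<^sub>p [:h, 1:]) < \<rho>"
proof -
  define q' g' where "q' = q \<circ>\<^sub>p [:h, 1:]" and "g' = g \<circ>\<^sub>p [:pcoeff h \<rho>, 1:]"
  have nz: "coeff q' 0 \<noteq> 0" using nz by (simp add: q'_def)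
  have init: "initial_form \<rho> V q' g'" unfolding q'_def g'_def by (rule initial_form_shift[OF g(1) h])
  define i where "i = degree g'"
  have i: "i > 0" using g(2) by (simp add: i_def g'_def degree_pcompose)
  then have "g' \<noteq> 0" by (auto simp: i_def)
  then have "coeff g' i \<noteq> 0" by (simp add: i_def)
  then have "coeff q' i \<noteq> 0" "leading_exponent (coeff q' i) = V - real i * \<rho>"
    using leading_exponent_eqI[of "coeff q' i" "V - real i * \<rho>"] init by (auto simp: initial_form_def)
  then have slope: "newton_slope q' \<le> (leading_exponent (coeff q' 0) - V) / real i + \<rho>"
    using newton_slope_le[OF i, of q'] i by (simp add: field_simps)
  have V: "exps_le (coeff q' 0) V" "pcoeff (coeff q' 0) V = coeff g' 0"
    using init[unfolded initial_form_def, rule_format, of 0] by auto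
  then have le: "leading_exponent (coeff q' 0) \<le> V" using nz by (simp add: exps_le_iff)
  then have "(leading_exponent (coeff q' 0) - V) / real i \<le> 0"
    using i by (simp add: divide_nonpos_pos)
  then show "newton_slope (q \<circ>\<^sub>p [:h, 1:]) \<le> \<rho>" using slope by (simp add: q'_def)
  assume "poly g (pcoeff h \<rho>) = 0"
  then have "coeff g' 0 = 0" by (simp add: g'_def)
  then have "leading_exponent (coeff q' 0) \<noteq> V"
    using V(2) pcoeff_leading_exponent[OF nz] by auto
  then have "(leading_exponent (coeff q' 0) - V) / real i < 0"
    using le i by (simp add: divide_neg_pos)
  then show "newton_slope (q \<circ>\<^sub>p [:h, 1:]) < \<rho>" using slope by (simp add: q'_def)
qed

text \<open>Newton's step always makes a non-root better, and the balls that contain the successive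
  approximations are nested; a maximal chain of them would have a limit that can be improved.\<close>

theorem puiseux_root_exists:
  fixes p :: "complex puiseux poly"
  assumes deg: "degree p > 0"
  shows "\<exists>z. poly p z = 0"
proof (rule ccontr)
  assume "\<nexists>z. poly p z = 0"
  then have nz: "poly p z \<noteq> 0" for z by blast
  define q where "q a = p \<circ>\<^sub>p [:a, 1:]" for a
  have q0: "coeff (q a) 0 \<noteq> 0" and qdeg: "degree (q a) > 0" for a
    using nz deg by (simp_all add: q_def degree_pcompose)
  have q_shift: "q a \<circ>\<^sub>p [:b - a, 1:] = q b" for a b
    by (simp add: q_def pcompose_assoc[symmetric] pcompose_pCons)
  define \<rho> where "\<rho> a = newton_slope (q a)" for a
  have mono: "\<rho> b \<le> \<rho> a" if "exps_le (b - a) (\<rho> a)" for a b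
  proof -
    obtain g where "initial_form (\<rho> a) (leading_exponent (coeff (q a) 0)) (q a) g" "degree g > 0"
      using initial_form_newton_slope[OF q0 qdeg] unfolding \<rho>_def by blast
    from newton_slope_shift(1)[OF this that] show ?thesis
      unfolding q_shift by (simp add: \<rho>_def q0)
  qed
  have improve: "\<exists>b. exps_le (b - a) (\<rho> a) \<and> \<rho> b < \<rho> a" for a
  proof -
    obtain g where g: "initial_form (\<rho> a) (leading_exponent (coeff (q a) 0)) (q a) g" "degree g > 0"
      using initial_form_newton_slope[OF q0 qdeg] unfolding \<rho>_def by blast
    obtain c where c: "poly g c = 0"
      using fundamental_theorem_of_algebra_alt[of g] g(2) by (metis degree_pCons_0 less_irrefl)
    define b where "b = a + pmono c (\<rho> a)"
    have b: "exps_le (b - a) (\<rho> a)" "pcoeff (b - a) (\<rho> a) = c" by (simp_all add: b_def)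
    have "\<rho> b < \<rho> a"
      using newton_slope_shift(2)[OF g b(1)] c unfolding q_shift b(2) by (simp add: \<rho>_def q0)
    with b(1) show ?thesis by blast
  qed
  \<comment> \<open>Countably many improvements need not reach a root, because the slopes may
    decrease to a limit; hence chains of arbitrary length, with a maximal one from Hausdorff's
    principle.\<close>
  define P where "P a b \<longleftrightarrow> exps_le (b - a) (\<rho> a) \<and> \<rho> b < \<rho> a" for a b
  obtain C where C: "pred_on.maxchain UNIV P C" using pred_on.Hausdorff by blast
  have chain: "P a b \<or> P b a \<or> a = b" if "a \<in> C" "b \<in> C" for a b
    using C that unfolding pred_on.maxchain_def pred_on.chain_def by blast
  have "exps_le (b - a) (max (\<rho> a) (\<rho> b))" if ab: "a \<in> C" "b \<in> C" for a b
  proof -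
    have *: "exps_le (b - a) k \<longleftrightarrow> exps_le (a - b) k" for k
      using exps_le_uminus[of "b - a" k] by simp
    consider "P a b" | "P b a" | "a = b" using chain[OF ab] by blast
    then show ?thesis
      by cases (auto simp: P_def * max_def intro: exps_le_mono)
  qed
  then obtain x where x: "\<And>a. a \<in> C \<Longrightarrow> exps_le (x - a) (\<rho> a)"
    using nested_balls_inhabited[of C \<rho>] by blast
  obtain b where b: "exps_le (b - x) (\<rho> x)" "\<rho> b < \<rho> x" using improve by blast
  have above: "P a b" if "a \<in> C" for a
  proof -
    have "\<rho> x \<le> \<rho> a" by (rule mono[OF x[OF that]])
    moreover from this have "exps_le ((b - x) + (x - a)) (\<rho> a)"
      using b(1) x[OF that] by (intro exps_le_add) (auto intro: exps_le_mono)
    ultimately show ?thesis using b(2) by (simp add: P_def)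
  qed
  have "b \<notin> C" using above[of b] by (auto simp: P_def)
  moreover have "pred_on.chain UNIV P (insert b C)"
    unfolding pred_on.chain_def using chain above by blast
  ultimately show False
    using C unfolding pred_on.maxchain_def by blast
qed

section \<open>Inverses and linear factors over the complex series\<close>

definition pinverse :: "complex puiseux \<Rightarrow> complex puiseux"
  where "pinverse x = (SOME y. x * y = 1)"

text \<open>An inverse of x is a root of a linear polynomial, so no geometric series has to be
  constructed.\<close>

lemma mult_pinverse: "x \<noteq> 0 \<Longrightarrow> x * pinverse x = 1"
proof -
  assume "x \<noteq> 0"
  then have "degree [:- 1, x:] > 0" by simp
  then obtain y where "poly [:- 1, x:] y = 0" using puiseux_root_exists by blast
  then have "x * y = 1" by (simp add: mult.commute eq_neg_iff_add_eq_0[symmetric])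
  then show ?thesis unfolding pinverse_def by (rule someI)
qed

lemma pinverse_nonzero: "x \<noteq> 0 \<Longrightarrow> pinverse x \<noteq> 0"
  using mult_pinverse[of x] by auto

lemma leading_exponent_pinverse: "x \<noteq> 0 \<Longrightarrow> leading_exponent (pinverse x) = - leading_exponent x"
  using leading_exponent_mult[of x "pinverse x"] leading_exponent_pmono[of "1::complex" 0]
  by (simp add: mult_pinverse pinverse_nonzero pconst_1)

lemma puiseux_poly_splits:
  fixes p :: "complex puiseux poly"
  assumes "p \<noteq> 0"
  obtains rs where "length rs = degree p" "p = smult (lead_coeff p) (\<Prod>r\<leftarrow>rs. [:- r, 1:])"
proof -
  have "\<exists>rs. length rs = degree p \<and> p = smult (lead_coeff p) (\<Prod>r\<leftarrow>rs. [:- r, 1:])"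
    using assms
  proof (induction "degree p" arbitrary: p)
    case 0
    then show ?case by (auto elim: degree_eq_zeroE)
  next
    case (Suc n)
    then obtain r where "poly p r = 0" using puiseux_root_exists[of p] by auto
    then obtain p' where p': "p = [:- r, 1:] * p'" by (auto simp: poly_eq_0_iff_dvd)
    have "p' \<noteq> 0" using Suc.prems p' by auto
    then have deg: "degree p = Suc (degree p')"
      using p' by (simp add: degree_mult_eq del: mult_pCons_left)
    have lc: "lead_coeff p = lead_coeff p'"
      unfolding p' lead_coeff_mult by simp
    obtain rs where rs: "length rs = degree p'" "p' = smult (lead_coeff p') (\<Prod>r\<leftarrow>rs. [:- r, 1:])"
      using Suc(1)[of p'] Suc(2) deg \<open>p' \<noteq> 0\<close> by auto
    have "p = smult (lead_coeff p') ([:- r, 1:] * (\<Prod>r\<leftarrow>rs. [:- r, 1:]))"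
      using p' rs(2) unfolding mult_smult_right[symmetric] by (metis (no_types, lifting))
    then have "p = smult (lead_coeff p) (\<Prod>r\<leftarrow>r # rs. [:- r, 1:])"
      unfolding lc list.map prod_list.Cons .
    then show ?case using deg rs(1) by (intro exI[of _ "r # rs"]) simp
  qed
  then show thesis using that by blast
qed


section \<open>The ordered field and its half-planes\<close>

text \<open>Positive leading terms cannot cancel. The second claim is what later bounds a sum over
  all roots by the contribution of a single one.\<close>

lemma leading_coeff_add_pos:
  fixes x y :: "'a::linordered_idom puiseux"
  assumes x: "leading_coeff x > 0" and y: "leading_coeff y > 0"
  shows "leading_coeff (x + y) > 0"
    and "leading_exponent x \<le> leading_exponent (x + y)"
proof -
  let ?k = "max (leading_exponent x) (leading_exponent y)"
  have nz: "x \<noteq> 0" "y \<noteq> 0" using assms by auto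
  then have le: "exps_le x ?k" "exps_le y ?k" by (auto simp: exps_le_iff)
  have "0 < pcoeff (x + y) ?k"
  proof (cases "leading_exponent x" "leading_exponent y" rule: linorder_cases)
    case less
    then have "pcoeff x ?k = 0"
      using exps_leD[OF exps_le_leading_exponent[OF nz(1)]] by simp
    with less y show ?thesis by (simp add: plus_puiseux.rep_eq leading_coeff_def max_def)
  next
    case equal
    with x y show ?thesis by (simp add: plus_puiseux.rep_eq leading_coeff_def)
  next
    case greater
    then have "pcoeff y ?k = 0"
      using exps_leD[OF exps_le_leading_exponent[OF nz(2)]] by simp
    with greater x show ?thesis by (simp add: plus_puiseux.rep_eq leading_coeff_def max_def)
  qed
  with leading_exponent_eqI[OF exps_le_add[OF le]]
  show "leading_coeff (x + y) > 0" "leading_exponent x \<le> leading_exponent (x + y)" by auto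
qed

instantiation puiseux :: (linordered_idom) linordered_idom
begin

definition less_puiseux :: "'a puiseux \<Rightarrow> 'a puiseux \<Rightarrow> bool"
  where "less_puiseux x y \<longleftrightarrow> leading_coeff (y - x) > 0"

definition less_eq_puiseux :: "'a puiseux \<Rightarrow> 'a puiseux \<Rightarrow> bool"
  where "less_eq_puiseux x y \<longleftrightarrow> x = y \<or> x < y"

definition abs_puiseux :: "'a puiseux \<Rightarrow> 'a puiseux"
  where "abs_puiseux x = (if x < 0 then - x else x)"

definition sgn_puiseux :: "'a puiseux \<Rightarrow> 'a puiseux"
  where "sgn_puiseux x = (if x = 0 then 0 else if 0 < x then 1 else - 1)"

instance
proof
  fix x y z :: "'a puiseux"
  have trans: "x < z" if "x < y" "y < z" for x y z :: "'a puiseux"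
    using leading_coeff_add_pos(1)[of "z - y" "y - x"] that by (simp add: less_puiseux_def)
  have asym: "\<not> y < x" if "x < y" for x y :: "'a puiseux"
    using that leading_coeff_uminus[of "x - y"] by (simp add: less_puiseux_def)
  show "x < y \<longleftrightarrow> x \<le> y \<and> \<not> y \<le> x"
    using asym[of x y] by (auto simp: less_eq_puiseux_def less_puiseux_def)
  show "x \<le> x" by (simp add: less_eq_puiseux_def)
  show "x \<le> y \<Longrightarrow> y \<le> z \<Longrightarrow> x \<le> z"
    using trans[of x y z] by (auto simp: less_eq_puiseux_def)
  show "x \<le> y \<Longrightarrow> y \<le> x \<Longrightarrow> x = y"
    using asym[of x y] by (auto simp: less_eq_puiseux_def)
  show "x \<le> y \<or> y \<le> x"
  proof -
    have "leading_coeff (x - y) = - leading_coeff (y - x)"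
      using leading_coeff_uminus[of "x - y"] by simp
    moreover have "leading_coeff (y - x) \<noteq> 0" if "x \<noteq> y"
      using leading_coeff_nz[of "y - x"] that by simp
    ultimately show ?thesis by (auto simp: less_eq_puiseux_def less_puiseux_def)
  qed
  show "x \<le> y \<Longrightarrow> z + x \<le> z + y"
    by (auto simp: less_eq_puiseux_def less_puiseux_def)
  show "x < y \<Longrightarrow> 0 < z \<Longrightarrow> z * x < z * y"
    by (simp add: less_puiseux_def right_diff_distrib[symmetric] leading_coeff_mult)
  show "\<bar>x\<bar> = (if x < 0 then - x else x)" by (rule abs_puiseux_def)
  show "sgn x = (if x = 0 then 0 else if 0 < x then 1 else - 1)" by (rule sgn_puiseux_def)
qed

end

lemma puiseux_pos_iff: "puiseux_pos x \<longleftrightarrow> 0 < x"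
  by (auto simp: puiseux_pos_def less_puiseux_def)

lemma leading_exponent_add_mono:
  fixes x y :: "'a::linordered_idom puiseux"
  assumes "0 < x" "0 \<le> y"
  shows "leading_exponent x \<le> leading_exponent (x + y)"
  using assms leading_coeff_add_pos(2)[of x y]
  by (cases "y = 0") (auto simp: less_puiseux_def less_eq_puiseux_def)

section \<open>Real parts, imaginary parts and reciprocals\<close>

lemma pRe_simps [simp]:
  "pRe 0 = 0" "pRe 1 = 1" "pRe (x + y) = pRe x + pRe y" "pRe (- x) = - pRe x"
  "pRe (x - y) = pRe x - pRe y"
  by (rule puiseux_eqI, simp add: pRe.rep_eq zero_puiseux.rep_eq one_puiseux.rep_eq
      plus_puiseux.rep_eq uminus_puiseux.rep_eq pcoeff_minus)+

lemma pIm_simps [simp]: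
  "pIm 0 = 0" "pIm 1 = 0" "pIm (x + y) = pIm x + pIm y" "pIm (- x) = - pIm x"
  "pIm (x - y) = pIm x - pIm y"
  by (rule puiseux_eqI, simp add: pIm.rep_eq zero_puiseux.rep_eq one_puiseux.rep_eq
      plus_puiseux.rep_eq uminus_puiseux.rep_eq pcoeff_minus)+

text \<open>A convolution runs over the supports of its factors, and those of real and imaginary
  parts are possibly smaller than those of x and y. Widening all of them to the same index set lets
  the partial products be combined termwise.\<close>

lemma pcoeff_part_times:
  fixes f g :: "complex puiseux \<Rightarrow> real puiseux"
  assumes "f' 0 = 0" "g' 0 = 0" "\<And>x k. pcoeff (f x) k = f' (pcoeff x k)"
    "\<And>x k. pcoeff (g x) k = g' (pcoeff x k)"
  shows "pcoeff (f x * g y) k =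
    (\<Sum>i | pcoeff x i \<noteq> 0 \<and> pcoeff y (k - i) \<noteq> 0. f' (pcoeff x i) * g' (pcoeff y (k - i)))"
proof -
  have "{i. pcoeff (f x) i \<noteq> 0 \<and> pcoeff (g y) (k - i) \<noteq> 0} \<subseteq> {i. pcoeff x i \<noteq> 0 \<and> pcoeff y (k - i) \<noteq> 0}"
    unfolding assms(3,4) using assms(1,2) by (intro Collect_mono) (metis (no_types))
  from pcoeff_times_superset[OF finite_pcoeff_fibre this] show ?thesis
    by (simp only: assms(3,4))
qed

lemma pRe_mult: "pRe (x * y) = pRe x * pRe y - pIm x * pIm y"
proof (rule puiseux_eqI)
  fix k
  have "pcoeff (pRe x * pRe y) k =
      (\<Sum>i | pcoeff x i \<noteq> 0 \<and> pcoeff y (k - i) \<noteq> 0. Re (pcoeff x i) * Re (pcoeff y (k - i)))"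
    by (rule pcoeff_part_times) (simp_all add: pRe.rep_eq)
  moreover have "pcoeff (pIm x * pIm y) k =
      (\<Sum>i | pcoeff x i \<noteq> 0 \<and> pcoeff y (k - i) \<noteq> 0. Im (pcoeff x i) * Im (pcoeff y (k - i)))"
    by (rule pcoeff_part_times) (simp_all add: pIm.rep_eq)
  ultimately show "pcoeff (pRe (x * y)) k = pcoeff (pRe x * pRe y - pIm x * pIm y) k"
    by (simp only: pRe.rep_eq pcoeff_minus times_puiseux.rep_eq[of x y] Re_sum
        complex_mult sum_subtractf[symmetric]) simp
qed

lemma pIm_mult: "pIm (x * y) = pRe x * pIm y + pIm x * pRe y"
proof (rule puiseux_eqI)
  fix k
  have "pcoeff (pRe x * pIm y) k =
      (\<Sum>i | pcoeff x i \<noteq> 0 \<and> pcoeff y (k - i) \<noteq> 0. Re (pcoeff x i) * Im (pcoeff y (k - i)))"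
    by (rule pcoeff_part_times) (simp_all add: pRe.rep_eq pIm.rep_eq)
  moreover have "pcoeff (pIm x * pRe y) k =
      (\<Sum>i | pcoeff x i \<noteq> 0 \<and> pcoeff y (k - i) \<noteq> 0. Im (pcoeff x i) * Re (pcoeff y (k - i)))"
    by (rule pcoeff_part_times) (simp_all add: pRe.rep_eq pIm.rep_eq)
  ultimately show "pcoeff (pIm (x * y)) k = pcoeff (pRe x * pIm y + pIm x * pRe y) k"
    by (simp only: pIm.rep_eq plus_puiseux.rep_eq times_puiseux.rep_eq[of x y] Im_sum
        complex_mult sum.distrib[symmetric]) simp
qed

lemma puiseux_complex_eqI: "pRe x = pRe y \<Longrightarrow> pIm x = pIm y \<Longrightarrow> x = y"
  by (metis puiseux_Re_Im(1))

definition pnorm2 :: "complex puiseux \<Rightarrow> real puiseux"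
  where "pnorm2 z = pRe z * pRe z + pIm z * pIm z"

lemma pnorm2_pos: "z \<noteq> 0 \<Longrightarrow> 0 < pnorm2 z"
  using puiseux_complex_eqI[of z 0] by (auto simp: pnorm2_def sum_squares_gt_zero_iff)

lemma pnorm2_mult: "pnorm2 (x * y) = pnorm2 x * pnorm2 y"
  by (simp add: pnorm2_def pRe_mult pIm_mult algebra_simps)

lemma pIm_inverse:
  assumes "z * q = 1"
  shows "pIm q * pnorm2 z = - pIm z"
proof -
  have "pRe z * pRe q - pIm z * pIm q = 1" "pRe z * pIm q + pIm z * pRe q = 0"
    using arg_cong[OF assms, of pRe] arg_cong[OF assms, of pIm] by (simp_all add: pRe_mult pIm_mult)
  then show ?thesis unfolding pnorm2_def by algebra
qed

lemma pIm_pinverse_sign: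
  assumes "z \<noteq> 0"
  shows "0 < pIm (pinverse z) \<longleftrightarrow> pIm z < 0" "pIm (pinverse z) < 0 \<longleftrightarrow> 0 < pIm z"
proof -
  have *: "pIm z = - (pIm (pinverse z) * pnorm2 z)"
    using pIm_inverse[OF mult_pinverse[OF assms]] by simp
  show "0 < pIm (pinverse z) \<longleftrightarrow> pIm z < 0" "pIm (pinverse z) < 0 \<longleftrightarrow> 0 < pIm z"
    unfolding * using pnorm2_pos[OF assms] by (auto simp: zero_less_mult_iff mult_less_0_iff)
qed

section \<open>Location of zeros: Gauss--Lucas, Laguerre, Grace--Walsh--Szego\<close>

lemma poly_prod_roots_eq_0_iff:
  fixes z :: "'a::idom"
  shows "poly (\<Prod>r\<leftarrow>rs. [:- r, 1:]) z = 0 \<longleftrightarrow> z \<in> set rs"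
  by (induction rs) auto

lemma poly_pderiv_prod_roots:
  assumes "z \<notin> set rs"
  shows "poly (pderiv (\<Prod>r\<leftarrow>rs. [:- r, 1:])) z =
    poly (\<Prod>r\<leftarrow>rs. [:- r, 1:]) z * (\<Sum>r\<leftarrow>rs. pinverse (z - r))"
  using assms
proof (induction rs)
  case (Cons r rs)
  have inv: "(z - r) * pinverse (z - r) = 1"
    using Cons.prems by (intro mult_pinverse) auto
  have "pderiv [:- r, 1:] = 1" by (simp add: pderiv_pCons)
  moreover have "(z - r) * P * (pinverse (z - r) + S) = (z - r) * (P * S) + P" for P S
  proof -
    have "(z - r) * P * (pinverse (z - r) + S) = (z - r) * pinverse (z - r) * P + (z - r) * (P * S)"
      by (simp only: distrib_left mult_ac)
    then show ?thesis by (simp add: inv)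
  qed
  ultimately show ?case
    using Cons by (simp add: pderiv_mult del: mult_pCons_left mult_pCons_right)
qed simp

lemma sum_list_pIm: "pIm (sum_list xs) = (\<Sum>x\<leftarrow>xs. pIm x)"
  by (induction xs) auto

text \<open>The logarithmic derivative is the sum of 1 / (z - r) over the roots r. Below all roots
  every summand has positive imaginary part, so the sum is nonzero.\<close>

lemma gauss_lucas_lower_half_plane:
  fixes p :: "complex puiseux poly"
  assumes nv: "\<And>z. pIm z < 0 \<Longrightarrow> poly p z \<noteq> 0" and "pderiv p \<noteq> 0" and z: "pIm z < 0"
  shows "poly (pderiv p) z \<noteq> 0"
proof -
  have "p \<noteq> 0" using assms(2) by auto
  then obtain rs where rs: "length rs = degree p" "p = smult (lead_coeff p) (\<Prod>r\<leftarrow>rs. [:- r, 1:])"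
    by (rule puiseux_poly_splits)
  define c where "c = lead_coeff p"
  have p: "p = smult c (\<Prod>r\<leftarrow>rs. [:- r, 1:])" using rs(2) by (simp add: c_def)
  have "rs \<noteq> []" using assms(2) rs(1) by (auto simp: pderiv_eq_0_iff)
  have roots: "0 \<le> pIm r" if "r \<in> set rs" for r
    using nv[of r] that unfolding p by (force simp: poly_prod_roots_eq_0_iff)
  have "z \<notin> set rs" using roots[of z] z by auto
  have "0 < (\<Sum>r\<leftarrow>rs. pIm (pinverse (z - r)))"
    using \<open>rs \<noteq> []\<close> roots
  proof (induction rs rule: list_nonempty_induct)
    case (single r)
    have "z - r \<noteq> 0" "pIm (z - r) < 0" using single.prems[of r] z by auto
    then show ?case by (simp add: pIm_pinverse_sign)
  next
    case (cons r rs)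
    have "z - r \<noteq> 0" "pIm (z - r) < 0" using cons.prems[of r] z by auto
    then show ?case using cons by (simp add: pIm_pinverse_sign add_pos_pos)
  qed
  then have "(\<Sum>r\<leftarrow>rs. pinverse (z - r)) \<noteq> 0"
    using sum_list_pIm[of "map (\<lambda>r. pinverse (z - r)) rs"] by (auto simp: o_def)
  moreover have "poly p z \<noteq> 0" by (rule nv[OF z])
  ultimately show ?thesis
    unfolding p by (simp add: pderiv_smult poly_pderiv_prod_roots[OF \<open>z \<notin> set rs\<close>])
qed

text \<open>For \<open>y > 0\<close> the condition \<open>y * pnorm2 q + pIm q \<le> 0\<close> describes a closed disc: the
  reciprocals of the points with imaginary part at least \<open>y\<close>, and \<open>0\<close>. Discs are convex.\<close>

lemma disc_convex:
  fixes y :: "real puiseux"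
  assumes y: "0 < y" and qs: "\<And>q. q \<in> set qs \<Longrightarrow> y * pnorm2 q + pIm q \<le> 0"
    and sum: "sum_list qs = of_nat (length qs) * q0" and ne: "qs \<noteq> []"
  shows "y * pnorm2 q0 + pIm q0 \<le> 0"
proof -
  \<comment> \<open>\<open>l\<close> is the differential at q0 of the convex function q -> y |q|^2 +
    Im q. Summing the tangent inequalities over the list leaves only the constant term, because the
    deviations from the mean q0 add up to 0.\<close>
  define l where "l d = 2 * y * (pRe q0 * pRe d + pIm q0 * pIm d) + pIm d" for d
  let ?c = "y * pnorm2 q0 + pIm q0"
  have l_add: "l (a + b) = l a + l b" for a b by (simp add: l_def algebra_simps)
  have tangent: "?c + l (q - q0) \<le> y * pnorm2 q + pIm q" for q
  proof -
    have "y * pnorm2 q + pIm q - (?c + l (q - q0)) =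
        y * ((pRe q - pRe q0) * (pRe q - pRe q0) + (pIm q - pIm q0) * (pIm q - pIm q0))"
      by (simp add: l_def pnorm2_def algebra_simps)
    also have "\<dots> \<ge> 0" by (intro mult_nonneg_nonneg add_nonneg_nonneg zero_le_square less_imp_le[OF y])
    finally show ?thesis by simp
  qed
  have "of_nat (length qs) * ?c + l (sum_list qs - of_nat (length qs) * q0) \<le> 0"
    using qs
  proof (induction qs)
    case Nil
    then show ?case by (simp add: l_def)
  next
    case (Cons q qs)
    have "?c + l (q - q0) \<le> 0" using tangent[of q] Cons.prems[of q] by simp
    moreover have "of_nat (length qs) * ?c + l (sum_list qs - of_nat (length qs) * q0) \<le> 0"
      using Cons by simp
    moreover have split: "sum_list (q # qs) - of_nat (length (q # qs)) * q0 =
        (q - q0) + (sum_list qs - of_nat (length qs) * q0)"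
      by (simp add: algebra_simps)
    have "of_nat (length (q # qs)) * ?c + l (sum_list (q # qs) - of_nat (length (q # qs)) * q0) =
        (?c + l (q - q0)) + (of_nat (length qs) * ?c + l (sum_list qs - of_nat (length qs) * q0))"
      unfolding split l_add by (simp add: distrib_right)
    with calculation show ?case by (metis add_nonpos_nonpos)
  qed
  then have "of_nat (length qs) * ?c \<le> 0" by (simp add: sum l_def)
  then show ?thesis using ne by (auto simp: mult_le_0_iff)
qed

text \<open>If the expression vanished, 1 / (z - w) would be the mean of the k numbers 1 / (z - r),
  missing roots counting as roots at infinity. Since Im (z - r) is at least Im z, each of them lies
  in the disc of \<open>disc_convex\<close> with y = Im z, and hence so does the mean. Then Im (z -
  w) is at least Im z, so Im w is not positive.\<close>

lemma laguerre_upper_half_plane: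
  fixes p :: "complex puiseux poly"
  assumes nv: "\<And>z. 0 < pIm z \<Longrightarrow> poly p z \<noteq> 0" and deg: "degree p \<le> k" and k: "0 < k"
    and z: "0 < pIm z" and w: "0 < pIm w"
  shows "of_nat k * poly p z + (w - z) * poly (pderiv p) z \<noteq> 0"
proof
  assume eq: "of_nat k * poly p z + (w - z) * poly (pderiv p) z = 0"
  have pz: "poly p z \<noteq> 0" by (rule nv[OF z])
  then have "p \<noteq> 0" by auto
  then obtain rs where rs: "length rs = degree p" "p = smult (lead_coeff p) (\<Prod>r\<leftarrow>rs. [:- r, 1:])"
    by (rule puiseux_poly_splits)
  define c where "c = lead_coeff p"
  have p: "p = smult c (\<Prod>r\<leftarrow>rs. [:- r, 1:])" using rs(2) by (simp add: c_def)
  have roots: "pIm r \<le> 0" if "r \<in> set rs" for r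
    using nv[of r] that unfolding p by (force simp: poly_prod_roots_eq_0_iff)
  have "z \<notin> set rs" using roots[of z] z by auto
  define S where "S = (\<Sum>r\<leftarrow>rs. pinverse (z - r))"
  have "poly (pderiv p) z = poly p z * S"
    unfolding p by (simp add: pderiv_smult poly_pderiv_prod_roots[OF \<open>z \<notin> set rs\<close>] S_def)
  with eq have "poly p z * (of_nat k - (z - w) * S) = 0" by (simp add: algebra_simps)
  with pz have S: "(z - w) * S = of_nat k" by simp
  define q0 where "q0 = pinverse (z - w)"
  have zw: "z - w \<noteq> 0" using S k by auto
  then have q0: "(z - w) * q0 = 1" by (simp add: q0_def mult_pinverse)
  have S': "S = of_nat k * q0"
  proof -
    have "S = ((z - w) * q0) * S" by (simp add: q0)
    also have "\<dots> = ((z - w) * S) * q0" by (simp only: mult_ac)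
    finally show ?thesis by (simp only: S)
  qed
  have disc: "(pIm z * pnorm2 q + pIm q) * pnorm2 v = pIm z - pIm v" if "v * q = 1" for v q
  proof -
    have "pnorm2 v * pnorm2 q = 1"
      using pnorm2_mult[of v q] that by (simp add: pnorm2_def)
    moreover have "(pIm z * pnorm2 q + pIm q) * pnorm2 v = pIm z * (pnorm2 v * pnorm2 q) + pIm q * pnorm2 v"
      by (simp only: distrib_right) (simp only: mult_ac)
    ultimately show ?thesis by (simp add: pIm_inverse[OF that])
  qed
  \<comment> \<open>The padding by 0 stands for the reciprocals of the roots at infinity.\<close>
  define qs where "qs = map (\<lambda>r. pinverse (z - r)) rs @ replicate (k - length rs) 0"
  have "pIm z * pnorm2 q0 + pIm q0 \<le> 0"
  proof (rule disc_convex[OF z])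
    show "qs \<noteq> []" using k deg rs(1) by (auto simp: qs_def)
    show "sum_list qs = of_nat (length qs) * q0"
      using S' deg rs(1) by (simp add: qs_def S_def sum_list_replicate)
    fix q assume "q \<in> set qs"
    then consider "q = 0" | r where "r \<in> set rs" "q = pinverse (z - r)" by (auto simp: qs_def)
    then show "pIm z * pnorm2 q + pIm q \<le> 0"
    proof cases
      case 2
      then have v: "z - r \<noteq> 0" using \<open>z \<notin> set rs\<close> by auto
      then have "(pIm z * pnorm2 q + pIm q) * pnorm2 (z - r) \<le> 0"
        using disc[of "z - r" q] roots[of r] 2 by (simp add: mult_pinverse)
      then show ?thesis using pnorm2_pos[OF v] by (auto simp: mult_le_0_iff)
    qed (simp add: pnorm2_def)
  qed
  then have "(pIm z * pnorm2 q0 + pIm q0) * pnorm2 (z - w) \<le> 0"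
    using pnorm2_pos[OF zw] by (simp add: mult_nonpos_nonneg)
  with disc[OF q0] w show False by simp
qed

lemma sum_Pow_insert:
  assumes "finite I" "a \<notin> I"
  shows "sum f (Pow (insert a I)) = (\<Sum>T\<in>Pow I. f T + f (insert a T))"
proof -
  have "sum f (Pow (insert a I)) = sum f (Pow I) + sum f (insert a ` Pow I)"
    unfolding Pow_insert using assms by (intro sum.union_disjoint) auto
  also have "sum f (insert a ` Pow I) = (\<Sum>T\<in>Pow I. f (insert a T))"
    using assms by (subst sum.reindex) (auto simp: inj_on_def insert_eq_iff)
  finally show ?thesis by (simp add: sum.distrib)
qed

lemma pIm_pmono_pos: "0 < pIm (pmono c e) \<longleftrightarrow> 0 < Im c"
proof -
  have "pIm (pmono c e) = pmono (Im c) e" by (rule puiseux_eqI) (simp add: pIm.rep_eq)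
  then show ?thesis by (simp add: less_puiseux_def)
qed

text \<open>The sum is the polarization of p. Fixing one of its variables at w gives, up to a
  nonzero factor, the polarization of a polynomial of degree one less, which Laguerre's theorem
  keeps free of zeros in the half-plane.\<close>

lemma grace_walsh_szego:
  fixes p :: "complex puiseux poly" and z :: "'e \<Rightarrow> complex puiseux"
  assumes "finite I" "\<And>z. 0 < pIm z \<Longrightarrow> poly p z \<noteq> 0" "degree p \<le> card I"
    and "\<And>e. e \<in> I \<Longrightarrow> 0 < pIm (z e)"
  shows "(\<Sum>T\<in>Pow I. coeff p (card T) * pconst (1 / of_nat (card I choose card T)) * (\<Prod>e\<in>T. z e)) \<noteq> 0"
  using assms
proof (induction I arbitrary: p rule: finite_induct)
  case empty
  have "poly p (pmono \<i> 0) \<noteq> 0" by (rule empty.prems) (simp add: pIm_pmono_pos)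
  with empty.prems(2) show ?case by (auto elim!: degree_eq_zeroE simp: pconst_1)
next
  case (insert a I)
  define n where "n = card I"
  have card: "card (insert a I) = Suc n" using insert.hyps by (simp add: n_def)
  define w where "w = z a"
  \<comment> \<open>This is the polar derivative (n + 1) p(x) + (w - x) p'(x) with pole w; the
    coefficients of degree n + 1 cancel.\<close>
  define Q where "Q = smult (of_nat (Suc n)) p + [:w, -1:] * pderiv p"
  have coeff_Q: "coeff Q i = (of_nat (Suc n) - of_nat i) * coeff p i + w * of_nat (Suc i) * coeff p (Suc i)" for i
    by (cases i) (simp_all add: Q_def coeff_pderiv coeff_pCons algebra_simps)
  have Q_nv: "poly Q x \<noteq> 0" if "0 < pIm x" for x
    using laguerre_upper_half_plane[OF insert.prems(1), of "Suc n" x w] insert.prems that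
    by (simp add: Q_def w_def card algebra_simps)
  have "degree Q \<le> n"
  proof (rule degree_le, intro allI impI)
    fix i assume "n < i"
    then have "degree p < Suc i" "i = Suc n \<or> degree p < i" using insert.prems(2) card by auto
    then show "coeff Q i = 0" by (auto simp: coeff_Q coeff_eq_0)
  qed
  then have IH: "(\<Sum>T\<in>Pow I. coeff Q (card T) * pconst (1 / of_nat (n choose card T)) * (\<Prod>e\<in>T. z e)) \<noteq> 0"
    using insert.IH[of Q] Q_nv insert.prems(3) by (simp add: n_def)
  let ?t = "\<lambda>T. coeff p (card T) * pconst (1 / of_nat (Suc n choose card T)) * (\<Prod>e\<in>T. z e)"
  have "coeff Q (card T) * pconst (1 / of_nat (n choose card T)) * (\<Prod>e\<in>T. z e) =
      of_nat (Suc n) * (?t T + ?t (insert a T))" if "T \<in> Pow I" for T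
  proof -
    have T: "finite T" "a \<notin> T" "card T \<le> n"
      using that insert.hyps finite_subset by (auto simp: n_def card_mono)
    define i where "i = card T"
    have i: "i \<le> n" using T by (simp add: i_def)
    have ch: "n choose i \<noteq> 0" "Suc n choose i \<noteq> 0" "Suc n choose Suc i \<noteq> 0"
      using i by (simp_all add: binomial_eq_0_iff del: binomial_Suc_Suc)
    \<comment> \<open>With i = |T|, the next identities match the two parts of coefficient i of Q
      with the subsets T and \<open>insert a T\<close>: (n+1-i) / C(n,i) = (n+1) / C(n+1,i) and
      (i+1) / C(n,i) = (n+1) / C(n+1,i+1). They are proved for complex numbers, where division is
      available, and moved to series by \<open>pconst\<close>.\<close>
    have "(Suc n - i) * (Suc n choose i) = Suc n * (n choose i)"
      using binomial_absorb_comp[of "Suc n" i] by simp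
    then have "(of_nat (Suc n) - of_nat i) * of_nat (Suc n choose i) = (of_nat (Suc n) * of_nat (n choose i) :: complex)"
      using i by (metis (no_types, lifting) le_SucI of_nat_diff of_nat_mult)
    then have e1: "(of_nat (Suc n) - of_nat i) * (1 / of_nat (n choose i)) = (of_nat (Suc n) * (1 / of_nat (Suc n choose i)) :: complex)"
      using ch by (simp add: field_simps del: binomial_Suc_Suc of_nat_Suc)
    have "Suc i * (Suc n choose Suc i) = Suc n * (n choose i)"
      by (rule Suc_times_binomial)
    then have "of_nat (Suc i) * of_nat (Suc n choose Suc i) = (of_nat (Suc n) * of_nat (n choose i) :: complex)"
      by (metis of_nat_mult)
    then have e2: "of_nat (Suc i) * (1 / of_nat (n choose i)) = (of_nat (Suc n) * (1 / of_nat (Suc n choose Suc i)) :: complex)"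
      using ch by (simp add: field_simps del: binomial_Suc_Suc of_nat_Suc)
    have d: "of_nat (Suc n) - of_nat i = (pconst (of_nat (Suc n) - of_nat i) :: complex puiseux)"
      by (rule puiseux_eqI) (simp add: of_nat_puiseux pcoeff_minus del: of_nat_Suc)
    have E1: "(of_nat (Suc n) - of_nat i) * pconst (1 / of_nat (n choose i)) =
        (of_nat (Suc n) * pconst (1 / of_nat (Suc n choose i)) :: complex puiseux)"
      unfolding d unfolding of_nat_puiseux pmono_mult e1 ..
    have E2: "of_nat (Suc i) * pconst (1 / of_nat (n choose i)) =
        (of_nat (Suc n) * pconst (1 / of_nat (Suc n choose Suc i)) :: complex puiseux)"
      unfolding of_nat_puiseux pmono_mult e2 ..
    have "card (insert a T) = Suc i" "(\<Prod>e\<in>insert a T. z e) = w * (\<Prod>e\<in>T. z e)"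
      using T by (simp_all add: i_def w_def)
    moreover have "(A * c + w * B * c') * u * Z = N * (c * u1 * Z + c' * u2 * (w * Z))"
      if "A * u = N * u1" "B * u = N * u2" for A B N c c' u u1 u2 Z :: "complex puiseux"
    proof -
      have "(A * c + w * B * c') * u * Z = (A * u) * (c * Z) + (B * u) * (w * c' * Z)"
        by (simp only: distrib_right) (simp only: mult_ac)
      then show ?thesis unfolding that by (simp only: distrib_left mult_ac)
    qed
    note this[OF E1 E2]
    ultimately show ?thesis
      unfolding coeff_Q i_def[symmetric] by (simp only:)
  qed
  then have "(\<Sum>T\<in>Pow I. coeff Q (card T) * pconst (1 / of_nat (n choose card T)) * (\<Prod>e\<in>T. z e)) =
      of_nat (Suc n) * sum ?t (Pow (insert a I))"
    unfolding sum_Pow_insert[OF insert.hyps] sum_distrib_left by (intro sum.cong) auto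
  with IH show ?case by (auto simp: card)
qed


section \<open>An inequality for even-odd pencils\<close>

lemma leading_exponent_pIm:
  assumes "Im (leading_coeff z) \<noteq> 0"
  shows "leading_exponent (pIm z) = leading_exponent z" "pIm z \<noteq> 0"
proof -
  have "z \<noteq> 0" using assms by auto
  then have "exps_le (pIm z) (leading_exponent z)"
    using exps_le_leading_exponent[of z] by (auto simp: exps_le_def pIm.rep_eq)
  moreover have "pcoeff (pIm z) (leading_exponent z) \<noteq> 0"
    using assms by (simp add: pIm.rep_eq leading_coeff_def)
  ultimately show "leading_exponent (pIm z) = leading_exponent z" "pIm z \<noteq> 0"
    using leading_exponent_eqI by blast+
qed

lemma leading_exponent_pIm_le: "pIm z \<noteq> 0 \<Longrightarrow> leading_exponent (pIm z) \<le> leading_exponent z"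
proof -
  assume nz: "pIm z \<noteq> 0"
  then have "z \<noteq> 0" by auto
  then have "exps_le (pIm z) (leading_exponent z)"
    using exps_le_leading_exponent[of z] by (auto simp: exps_le_def pIm.rep_eq)
  with nz show ?thesis by (simp add: exps_le_iff)
qed

lemma leading_exponent_sum_list_nonneg:
  fixes xs :: "'a::linordered_idom puiseux list"
  assumes "x \<in> set xs" "0 < x" "\<And>y. y \<in> set xs \<Longrightarrow> 0 \<le> y"
  shows "0 < sum_list xs \<and> leading_exponent x \<le> leading_exponent (sum_list xs)"
  using assms
proof (induction xs)
  case (Cons y xs)
  have nonneg: "0 \<le> sum_list xs" using Cons.prems(3) by (intro sum_list_nonneg) auto
  show ?case
  proof (cases "x = y")
    case True
    then show ?thesis
      using Cons.prems(2) nonneg leading_exponent_add_mono[of x "sum_list xs"] by (simp add: add_pos_nonneg)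
  next
    case False
    then have IH: "0 < sum_list xs" "leading_exponent x \<le> leading_exponent (sum_list xs)"
      using Cons by auto
    have "0 \<le> y" using Cons.prems(3)[of y] by simp
    then show ?thesis
      using IH leading_exponent_add_mono[of "sum_list xs" y]
      by (auto simp: add_nonneg_pos add.commute[of y])
  qed
qed simp

lemma coeff_prod_roots_subleading:
  fixes rs :: "'a::comm_ring_1 list"
  shows "coeff (\<Prod>r\<leftarrow>rs. [:- r, 1:]) (length rs) = 1"
    and "length rs = Suc k \<Longrightarrow> coeff (\<Prod>r\<leftarrow>rs. [:- r, 1:]) k = - sum_list rs"
proof -
  have "degree (\<Prod>r\<leftarrow>rs. [:- r, 1:]) \<le> length rs" for rs :: "'a list"
  proof (induction rs)
    case (Cons r rs)
    have "degree ([:- r, 1:] * (\<Prod>r\<leftarrow>rs. [:- r, 1:])) \<le> 1 + degree (\<Prod>r\<leftarrow>rs. [:- r, 1:])"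
      using degree_mult_le[of "[:- r, 1:]"] by simp
    then show ?case using Cons by (simp del: mult_pCons_left)
  qed simp
  then have top: "coeff (\<Prod>r\<leftarrow>rs. [:- r, 1:]) (Suc (length rs)) = 0" for rs :: "'a list"
    by (intro coeff_eq_0) (simp add: le_imp_less_Suc)
  show lead: "coeff (\<Prod>r\<leftarrow>rs. [:- r, 1:]) (length rs) = 1" for rs :: "'a list"
    by (induction rs) (simp_all add: top)
  show "length rs = Suc k \<Longrightarrow> coeff (\<Prod>r\<leftarrow>rs. [:- r, 1:]) k = - sum_list rs"
  proof (induction rs arbitrary: k)
    case (Cons r rs)
    then have k: "k = length rs" by simp
    show ?case
    proof (cases rs)
      case Nil
      then show ?thesis using k by simp
    next
      case (Cons r' rs')
      define j where "j = length rs'"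
      have k': "length rs = Suc j" "k = Suc j" using Cons k by (simp_all add: j_def)
      then show ?thesis using Cons.IH[OF k'(1)] lead[of rs] k by (simp add: coeff_pCons)
    qed
  qed simp
qed

lemma leading_coeff_pinverse:
  assumes "x \<noteq> 0"
  shows "leading_coeff (pinverse x) = 1 / leading_coeff x"
proof -
  have "leading_coeff x * leading_coeff (pinverse x) = 1"
    unfolding leading_coeff_mult[symmetric] mult_pinverse[OF assms] pconst_1[symmetric] by simp
  then show ?thesis using leading_coeff_nz[OF assms] by (simp add: field_simps)
qed

lemma pmono_power: "pmono c e ^ n = pmono (c ^ n) (real n * e)" for c :: "'a::comm_ring_1"
  by (induction n) (simp_all add: pconst_1 pmono_mult algebra_simps)

text \<open>For large N the top term dominates at c t^N. The threshold exceeds all differences of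
  coefficient exponents and does not depend on c.\<close>

lemma leading_poly_at_large:
  fixes p :: "complex puiseux poly"
  assumes "p \<noteq> 0"
  shows "\<exists>N0. \<forall>N\<ge>N0. \<forall>c. c \<noteq> 0 \<longrightarrow> poly p (pmono c N) \<noteq> 0 \<and>
    leading_coeff (poly p (pmono c N)) = leading_coeff (lead_coeff p) * c ^ degree p"
proof -
  define m where "m = degree p"
  define l where "l i = leading_exponent (coeff p i)" for i
  define N0 where "N0 = 1 + (\<Sum>i\<le>m. \<bar>l i - l m\<bar>)"
  have N0: "l i - l m < N0" "0 \<le> N0" if "i \<le> m" for i
  proof -
    have "\<bar>l i - l m\<bar> \<le> (\<Sum>i\<le>m. \<bar>l i - l m\<bar>)" using that by (intro member_le_sum) auto
    then show "l i - l m < N0" "0 \<le> N0" by (auto simp: N0_def)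
  qed
  show ?thesis
  proof (intro exI[of _ N0] allI impI)
    fix N c assume N: "N0 \<le> N" and c: "(c::complex) \<noteq> 0"
    define K where "K = l m + real m * N"
    define t where "t i = coeff p i * pmono c N ^ i" for i
    have lm: "coeff p m \<noteq> 0" using assms by (simp add: m_def)
    have t_le: "exps_le (t i) (l i + real i * N)" for i
      unfolding t_def pmono_power
      by (cases "coeff p i = 0") (auto intro: exps_le_mult simp: l_def exps_le_leading_exponent)
    have t_small: "pcoeff (t i) K = 0 \<and> exps_le (t i) K" if "i < m" for i
    proof -
      have "l i - l m < N" "0 \<le> N" using N0[of i] that N by auto
      moreover have "1 * N \<le> (real m - real i) * N"
        using that \<open>0 \<le> N\<close> by (intro mult_right_mono) auto
      ultimately have "l i + real i * N < K" by (simp add: K_def algebra_simps)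
      then show ?thesis using t_le[of i] exps_le_mono exps_leD by fastforce
    qed
    have top: "exps_le (t m) K" "pcoeff (t m) K = leading_coeff (coeff p m) * c ^ m"
      using t_le[of m] pcoeff_mult_top[of "coeff p m" "l m" "pmono (c ^ m) (real m * N)" "real m * N"] lm
      by (auto simp: K_def t_def pmono_power l_def exps_le_leading_exponent leading_coeff_def)
    have poly: "poly p (pmono c N) = (\<Sum>i\<le>m. t i)" by (simp add: poly_altdef t_def m_def)
    have "exps_le (poly p (pmono c N)) K"
      unfolding poly using t_small top by (intro exps_le_sum) (metis atMost_iff le_neq_implies_less)
    moreover have "pcoeff (poly p (pmono c N)) K = pcoeff (t m) K"
      unfolding poly pcoeff_sum using t_small by (subst sum.remove[of _ m]) (auto intro!: sum.neutral)
    moreover have "leading_coeff (coeff p m) * c ^ m \<noteq> 0" using c lm leading_coeff_nz by simp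
    ultimately show "poly p (pmono c N) \<noteq> 0 \<and>
        leading_coeff (poly p (pmono c N)) = leading_coeff (lead_coeff p) * c ^ degree p"
      using leading_exponent_eqI[of "poly p (pmono c N)" K] top by (simp add: m_def)
  qed
qed

text \<open>\<kappa> times i and \<kappa> times e^(i pi/4) cannot both be real, as their quotient is
  not. An n-th root of either factor can be taken in the upper half-plane.\<close>

lemma nonreal_power_multiple:
  assumes "\<kappa> \<noteq> 0" "0 < n"
  obtains c :: complex where "0 < Im c" "Im (\<kappa> * c ^ n) \<noteq> 0"
proof -
  have pos: "0 < Im (cis (pi / (real k * real n)))" if "k \<ge> 2" for k
  proof -
    have "2 * 1 \<le> real k * real n" using that assms(2) by (intro mult_mono) auto
    then show ?thesis by (auto intro!: sin_gt_zero simp: field_simps)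
  qed
  have pow: "cis (pi / (real k * real n)) ^ n = cis (pi / real k)" for k
    using assms(2) by (simp add: Complex.DeMoivre field_simps)
  have "Im (\<kappa> * cis (pi / 2)) \<noteq> 0 \<or> Im (\<kappa> * cis (pi / 4)) \<noteq> 0"
    using assms(1) by (auto simp: complex_eq_iff cos_45 sin_45 distrib_right[symmetric])
  then show thesis
  proof
    assume "Im (\<kappa> * cis (pi / 2)) \<noteq> 0"
    then show thesis using that[of "cis (pi / (real 2 * real n))"] pos[of 2] unfolding pow by simp
  next
    assume "Im (\<kappa> * cis (pi / 4)) \<noteq> 0"
    then show thesis using that[of "cis (pi / (real 4 * real n))"] pos[of 4] unfolding pow by simp
  qed
qed

text \<open>The reversal is taken with respect to a given M rather than the degree. This keeps it
  linear, so that it acts on both members of a pencil at once.\<close>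

definition reverse_poly :: "nat \<Rightarrow> 'a::comm_ring_1 poly \<Rightarrow> 'a poly"
  where "reverse_poly M p = (\<Sum>i\<le>M. monom (coeff p (M - i)) i)"

lemma coeff_reverse_poly: "coeff (reverse_poly M p) i = (if i \<le> M then coeff p (M - i) else 0)"
  by (simp add: reverse_poly_def coeff_sum)

lemma poly_reverse_poly:
  fixes x y :: "'a::comm_ring_1"
  assumes "degree p \<le> M" "x * y = 1"
  shows "poly p x = x ^ M * poly (reverse_poly M p) y"
proof -
  have "poly (reverse_poly M p) y = (\<Sum>i\<le>M. coeff p (M - i) * y ^ i)"
    by (simp add: reverse_poly_def poly_sum poly_monom)
  also have "\<dots> = (\<Sum>i\<le>M. coeff p i * y ^ (M - i))"
    by (rule sum.reindex_bij_witness[of _ "\<lambda>i. M - i" "\<lambda>i. M - i"]) auto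
  finally have "x ^ M * poly (reverse_poly M p) y = (\<Sum>i\<le>M. coeff p i * (x ^ M * y ^ (M - i)))"
    by (simp add: sum_distrib_left mult_ac)
  also have "\<dots> = (\<Sum>i\<le>M. coeff p i * x ^ i)"
  proof (rule sum.cong[OF refl])
    fix i assume "i \<in> {..M}"
    then have "x ^ M = x ^ i * x ^ (M - i)" by (simp add: power_add[symmetric])
    then have "x ^ M * y ^ (M - i) = x ^ i * (x * y) ^ (M - i)"
      by (simp add: power_mult_distrib mult_ac)
    then show "coeff p i * (x ^ M * y ^ (M - i)) = coeff p i * x ^ i" by (simp add: assms(2))
  qed
  also have "\<dots> = poly p x"
    unfolding poly_altdef using assms(1)
    by (intro sum.mono_neutral_right) (auto simp: coeff_eq_0 not_le)
  finally show ?thesis ..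
qed

lemma higher_pderiv_lower_half_plane:
  fixes p :: "complex puiseux poly"
  assumes nv: "\<And>z. pIm z < 0 \<Longrightarrow> poly p z \<noteq> 0" and "j \<le> degree p"
  shows "(\<forall>z. pIm z < 0 \<longrightarrow> poly ((pderiv ^^ j) p) z \<noteq> 0) \<and> degree ((pderiv ^^ j) p) = degree p - j"
  using assms(2)
proof (induction j)
  case (Suc j)
  then have IH: "\<And>z. pIm z < 0 \<Longrightarrow> poly ((pderiv ^^ j) p) z \<noteq> 0" "degree ((pderiv ^^ j) p) = degree p - j"
    by auto
  have "pderiv ((pderiv ^^ j) p) \<noteq> 0" using Suc.prems IH(2) by (simp add: pderiv_eq_0_iff)
  then show ?case using gauss_lucas_lower_half_plane[OF IH(1)] IH(2) by (simp add: degree_pderiv)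
qed (use nv in simp)

lemma poly_minus_odd:
  fixes p :: "'a::comm_ring_1 poly"
  assumes "\<And>i. even i \<Longrightarrow> coeff p i = 0"
  shows "poly p (- x) = - poly p x"
proof -
  have "coeff p i * (- x) ^ i = - (coeff p i * x ^ i)" for i
    using assms[of i] by (cases "even i") auto
  then show ?thesis by (simp add: poly_altdef sum_negf)
qed

lemma poly_minus_even:
  fixes p :: "'a::comm_ring_1 poly"
  assumes "\<And>i. odd i \<Longrightarrow> coeff p i = 0"
  shows "poly p (- x) = poly p x"
proof -
  have "coeff p i * (- x) ^ i = coeff p i * x ^ i" for i
    using assms[of i] by (cases "even i") auto
  then show ?thesis by (simp add: poly_altdef)
qed

text \<open>With \<open>a\<close> odd and \<open>b\<close> even, choose \<open>w\<close> in the upper half-plane such that \<open>a + w b\<close> has a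
  root whose leading coefficient is not real. Its imaginary part cannot be cancelled in the
  sum of all roots, nor in the sum of their reciprocals.\<close>

lemma odd_even_pencil_inequality:
  fixes a b :: "complex puiseux poly"
  assumes nv: "\<And>y w. pIm y < 0 \<Longrightarrow> 0 < pIm w \<Longrightarrow> poly a y + w * poly b y \<noteq> 0"
    and a_odd: "\<And>i. even i \<Longrightarrow> coeff a i = 0" and b_even: "\<And>i. odd i \<Longrightarrow> coeff b i = 0"
    and deg_a: "degree a = d" and a: "a \<noteq> 0" and deg_b: "degree b < d" and b0: "coeff b 0 \<noteq> 0"
  shows "coeff a 1 \<noteq> 0" "coeff b (d - 1) \<noteq> 0"
    and "leading_exponent (coeff a d) + leading_exponent (coeff b 0)
      \<le> leading_exponent (coeff a 1) + leading_exponent (coeff b (d - 1))"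
proof -
  have b: "b \<noteq> 0" using b0 by auto
  define n where "n = d - degree b"
  have n: "0 < n" "d = degree b + n" using deg_b by (auto simp: n_def)
  have "odd d" using a a_odd[of d] deg_a leading_coeff_0_iff by blast
  obtain Na where Na: "\<forall>N\<ge>Na. \<forall>c. c \<noteq> 0 \<longrightarrow> poly a (pmono c N) \<noteq> 0 \<and>
    leading_coeff (poly a (pmono c N)) = leading_coeff (lead_coeff a) * c ^ degree a"
    using leading_poly_at_large[OF a] by blast
  obtain Nb where Nb: "\<forall>N\<ge>Nb. \<forall>c. c \<noteq> 0 \<longrightarrow> poly b (pmono c N) \<noteq> 0 \<and>
    leading_coeff (poly b (pmono c N)) = leading_coeff (lead_coeff b) * c ^ degree b"
    using leading_poly_at_large[OF b] by blast
  define N where "N = max Na Nb"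
  \<comment> \<open>Solving a + w b = 0 at y = c t^N gives w the leading coefficient
    \<open>\<kappa> * c ^ n\<close>; c is then chosen so that this is not real, hence w is not
    real.\<close>
  define \<kappa> where "\<kappa> = - (leading_coeff (lead_coeff a) / leading_coeff (lead_coeff b))"
  have lcs: "leading_coeff (lead_coeff a) \<noteq> 0" "leading_coeff (lead_coeff b) \<noteq> 0"
    using a b by (simp_all add: leading_coeff_nz)
  then have "\<kappa> \<noteq> 0" by (simp add: \<kappa>_def)
  then obtain c where c: "0 < Im c" "Im (\<kappa> * c ^ n) \<noteq> 0"
    using nonreal_power_multiple n(1) by blast
  have "c \<noteq> 0" using c(1) by auto
  define y where "y = pmono c N"
  have y: "0 < pIm y" using c(1) by (simp add: y_def pIm_pmono_pos)
  have ay: "leading_coeff (poly a y) = leading_coeff (lead_coeff a) * c ^ d"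
    and by_nz: "poly b y \<noteq> 0"
    and by': "leading_coeff (poly b y) = leading_coeff (lead_coeff b) * c ^ degree b"
    using Na[rule_format, of N c] Nb[rule_format, of N c] \<open>c \<noteq> 0\<close> by (auto simp: y_def N_def deg_a)
  define w where "w = - (poly a y * pinverse (poly b y))"
  have "leading_coeff w = \<kappa> * c ^ n"
    using ay by' lcs \<open>c \<noteq> 0\<close> n(2)
    by (simp add: w_def leading_coeff_mult leading_coeff_pinverse[OF by_nz] \<kappa>_def power_add field_simps)
  then have "pIm w \<noteq> 0" "w \<noteq> 0" using leading_exponent_pIm(2)[of w] c(2) by auto
  have root: "poly a y + w * poly b y = 0"
  proof -
    have "w * poly b y = - (poly a y * (poly b y * pinverse (poly b y)))"
      by (simp add: w_def mult_ac)
    then show ?thesis by (simp add: mult_pinverse[OF by_nz])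
  qed
  \<comment> \<open>Parity is used here: as a is odd and b is even, (-y, -w) is a zero of the pencil
    too, and it would lie in the forbidden region if w were in the lower half-plane.\<close>
  have w: "0 < pIm w"
  proof (rule ccontr)
    assume "\<not> 0 < pIm w"
    then have "0 < pIm (- w)" using \<open>pIm w \<noteq> 0\<close> by (simp add: not_less le_less)
    moreover have "pIm (- y) < 0" using y by simp
    ultimately have "poly a (- y) + (- w) * poly b (- y) \<noteq> 0" using nv by blast
    moreover have "poly a (- y) + (- w) * poly b (- y) = - (poly a y + w * poly b y)"
      by (simp add: poly_minus_odd[OF a_odd] poly_minus_even[OF b_even])
    ultimately show False using root by simp
  qed
  define G where "G = a + smult w b"
  have G_coeff: "coeff G i = (if even i then w * coeff b i else coeff a i)" for i
    using a_odd[of i] b_even[of i] by (simp add: G_def)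
  have deg_G: "degree G = d" and lead_G: "coeff G d = coeff a d"
    using deg_a deg_b \<open>odd d\<close> by (auto simp: G_def degree_add_eq_left degree_smult_eq coeff_eq_0)
  have "G \<noteq> 0" using lead_G a deg_a leading_coeff_0_iff by (metis coeff_0)
  then obtain rs where rs: "length rs = d" "G = smult (lead_coeff G) (\<Prod>r\<leftarrow>rs. [:- r, 1:])"
    using puiseux_poly_splits[of G] deg_G by metis
  have G: "G = smult (coeff a d) (\<Prod>r\<leftarrow>rs. [:- r, 1:])" using rs(2) by (simp add: deg_G lead_G)
  have ad: "coeff a d \<noteq> 0" using a deg_a leading_coeff_0_iff by blast
  have root_iff: "poly G r = 0 \<longleftrightarrow> r \<in> set rs" for r
    unfolding G using ad by (simp add: poly_prod_roots_eq_0_iff)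
  have roots: "0 \<le> pIm r" if "r \<in> set rs" for r
    using nv[OF _ w, of r] root_iff[of r] that by (force simp: G_def not_le[symmetric])
  have yrs: "y \<in> set rs" using root root_iff[of y] by (simp add: G_def)
  have G0: "coeff G 0 = w * coeff b 0" by (simp add: G_coeff)
  then have "poly G 0 \<noteq> 0" using b0 \<open>w \<noteq> 0\<close> by (simp add: poly_0_coeff_0)
  then have "0 \<notin> set rs" using root_iff by blast
  define S where "S = sum_list rs"
  define S' where "S' = (\<Sum>r\<leftarrow>rs. pinverse (- r))"
  have ly: "Im (leading_coeff y) \<noteq> 0" "leading_exponent y = N" "leading_exponent (pIm y) = N"
    using leading_exponent_pIm[of y] c(1) \<open>c \<noteq> 0\<close> by (simp_all add: y_def)
  have "0 < sum_list (map pIm rs) \<and> leading_exponent (pIm y) \<le> leading_exponent (sum_list (map pIm rs))"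
    using y yrs roots by (intro leading_exponent_sum_list_nonneg) auto
  then have S: "0 < pIm S" "N \<le> leading_exponent (pIm S)"
    by (simp_all add: S_def sum_list_pIm ly)
  then have "S \<noteq> 0" "N \<le> leading_exponent S"
    using leading_exponent_pIm_le[of S] by auto
  have "y \<noteq> 0" using \<open>c \<noteq> 0\<close> by (simp add: y_def)
  have y': "0 < pIm (pinverse (- y))" using y \<open>y \<noteq> 0\<close> by (simp add: pIm_pinverse_sign)
  have "Im (leading_coeff (pinverse (- y))) \<noteq> 0"
    using c(1) \<open>y \<noteq> 0\<close> by (simp add: leading_coeff_pinverse y_def Im_divide complex_eq_iff)
  then have ly': "leading_exponent (pIm (pinverse (- y))) = - N"
    using leading_exponent_pIm(1) \<open>y \<noteq> 0\<close> by (simp add: leading_exponent_pinverse ly)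
  have nonneg: "0 \<le> pIm (pinverse (- r))" if "r \<in> set rs" for r
  proof -
    have "- r \<noteq> 0" using that \<open>0 \<notin> set rs\<close> by auto
    then show ?thesis using pIm_pinverse_sign(2)[of "- r"] roots[OF that] by (simp add: not_less[symmetric])
  qed
  have "0 < (\<Sum>r\<leftarrow>rs. pIm (pinverse (- r))) \<and>
      leading_exponent (pIm (pinverse (- y))) \<le> leading_exponent (\<Sum>r\<leftarrow>rs. pIm (pinverse (- r)))"
    using y' yrs nonneg by (intro leading_exponent_sum_list_nonneg) auto
  then have S': "0 < pIm S'" "- N \<le> leading_exponent (pIm S')"
    by (simp_all add: S'_def sum_list_pIm ly' o_def)
  then have "S' \<noteq> 0" "- N \<le> leading_exponent S'"
    using leading_exponent_pIm_le[of S'] by auto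
  have "length rs = Suc (d - 1)" using \<open>odd d\<close> rs(1) by (cases d) auto
  then have "coeff G (d - 1) = coeff a d * - S"
    unfolding G S_def using coeff_prod_roots_subleading(2)[of rs "d - 1"] by simp
  \<comment> \<open>Vieta at both ends: the sum S of the roots involves a_d and b_(d-1), the sum S'
    of the negated reciprocals involves b_0 and a_1. Since nu(S) \<ge> N and nu(S') \<ge> -N, adding
    the two equations of exponents eliminates both w and N.\<close>
  then have E1: "w * coeff b (d - 1) = - (coeff a d * S)"
    using \<open>odd d\<close> by (simp add: G_coeff)
  have "poly (pderiv G) 0 = poly G 0 * S'"
    unfolding G using poly_pderiv_prod_roots[OF \<open>0 \<notin> set rs\<close>] by (simp add: pderiv_smult S'_def)
  then have E2: "coeff a 1 = w * coeff b 0 * S'"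
    by (simp add: poly_0_coeff_0 coeff_pderiv G_coeff)
  show nz: "coeff a 1 \<noteq> 0" "coeff b (d - 1) \<noteq> 0"
    using E1 E2 \<open>S \<noteq> 0\<close> \<open>S' \<noteq> 0\<close> ad b0 \<open>w \<noteq> 0\<close> by auto
  have "leading_exponent w + leading_exponent (coeff b (d - 1)) = leading_exponent (coeff a d) + leading_exponent S"
    using arg_cong[OF E1, of leading_exponent] nz \<open>w \<noteq> 0\<close> \<open>S \<noteq> 0\<close> ad by (simp add: leading_exponent_mult)
  moreover have "leading_exponent (coeff a 1) = leading_exponent w + leading_exponent (coeff b 0) + leading_exponent S'"
    using E2 \<open>w \<noteq> 0\<close> \<open>S' \<noteq> 0\<close> b0 by (simp add: leading_exponent_mult)
  ultimately show "leading_exponent (coeff a d) + leading_exponent (coeff b 0)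
      \<le> leading_exponent (coeff a 1) + leading_exponent (coeff b (d - 1))"
    using \<open>N \<le> leading_exponent S\<close> \<open>- N \<le> leading_exponent S'\<close> by linarith
qed

text \<open>The preceding lemma needs the index d to be the degree. Reversal moves the coefficients
  above d to the low end, where M - d derivatives remove them; the integer factors that arise have
  exponent 0. Reversal exchanges the half-planes, Gauss--Lucas preserves stability, and since d is
  odd the parities of the two members are exchanged.\<close>

lemma even_odd_pencil_inequality:
  fixes A B :: "complex puiseux poly"
  assumes nv: "\<And>x w. 0 < pIm x \<Longrightarrow> 0 < pIm w \<Longrightarrow> poly A x + w * poly B x \<noteq> 0"
    and A_even: "\<And>i. odd i \<Longrightarrow> coeff A i = 0" and B_odd: "\<And>i. even i \<Longrightarrow> coeff B i = 0"
    and A0: "coeff A 0 \<noteq> 0" and Bd: "coeff B d \<noteq> 0"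
  shows "coeff A (d - 1) \<noteq> 0" "coeff B 1 \<noteq> 0"
    and "leading_exponent (coeff A 0) + leading_exponent (coeff B d)
      \<le> leading_exponent (coeff A (d - 1)) + leading_exponent (coeff B 1)"
proof -
  have "odd d" using Bd B_odd by blast
  define M where "M = max (degree A) (degree B)"
  have "d \<le> M" using le_degree[OF Bd] by (simp add: M_def)
  define T where "T p = (pderiv ^^ (M - d)) (reverse_poly M p)" for p :: "complex puiseux poly"
  define \<mu> where "\<mu> i = (pochhammer (of_nat (Suc i)) (M - d) :: complex puiseux)" for i
  have mu: "\<mu> i \<noteq> 0" "leading_exponent (\<mu> i) = 0" for i
  proof -
    have "\<mu> i = of_nat (pochhammer (Suc i) (M - d))" by (simp add: \<mu>_def pochhammer_of_nat del: of_nat_Suc)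
    moreover have "pochhammer (Suc i) (M - d) \<noteq> 0" using pochhammer_pos[of "Suc i" "M - d"] by simp
    ultimately show "\<mu> i \<noteq> 0" "leading_exponent (\<mu> i) = 0" by simp_all
  qed
  have coeff_T: "coeff (T p) i = (if i \<le> d then \<mu> i * coeff p (d - i) else 0)" for p i
  proof -
    have "M - (i + (M - d)) = d - i" "i + (M - d) \<le> M \<longleftrightarrow> i \<le> d" using \<open>d \<le> M\<close> by auto
    then show ?thesis by (simp add: T_def coeff_higher_pderiv coeff_reverse_poly \<mu>_def)
  qed
  have T_pencil: "T A + smult w (T B) = T (A + smult w B)" for w
    by (rule poly_eqI) (simp add: coeff_T algebra_simps)
  have nv': "poly (T A) y + w * poly (T B) y \<noteq> 0" if y: "pIm y < 0" and w: "0 < pIm w" for y w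
  proof -
    define R where "R = A + smult w B"
    have deg_R: "degree R \<le> M"
      unfolding R_def M_def by (intro degree_add_le) (auto simp: degree_smult_le[THEN order_trans])
    \<comment> \<open>The constant term is that of A, as B is odd. So the reversed polynomial has
      degree exactly M, and none of the M - d derivatives vanishes identically.\<close>
    have "coeff R 0 \<noteq> 0" using A0 B_odd[of 0] by (simp add: R_def)
    then have "coeff (reverse_poly M R) M \<noteq> 0" by (simp add: coeff_reverse_poly)
    moreover have "degree (reverse_poly M R) \<le> M"
      by (intro degree_le) (simp add: coeff_reverse_poly)
    ultimately have rev: "degree (reverse_poly M R) = M" "reverse_poly M R \<noteq> 0"
      using le_degree le_antisym by (blast, force)
    have "poly (reverse_poly M R) v \<noteq> 0" if v: "pIm v < 0" for v
    proof
      assume 0: "poly (reverse_poly M R) v = 0"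
      have "v \<noteq> 0" using v by auto
      then have "pinverse v * v = 1" "0 < pIm (pinverse v)"
        using v by (simp_all add: mult_pinverse pIm_pinverse_sign mult.commute)
      then show False
        using poly_reverse_poly[OF deg_R, of "pinverse v" v] 0 nv[of "pinverse v" w] w
        by (simp add: R_def)
    qed
    then have "poly (T R) y \<noteq> 0"
      using higher_pderiv_lower_half_plane[of "reverse_poly M R" "M - d"] rev y by (simp add: T_def)
    then show ?thesis unfolding R_def T_pencil[symmetric] by simp
  qed
  have aT: "coeff (T A) d \<noteq> 0" using A0 mu by (simp add: coeff_T)
  have "degree (T A) \<le> d" "degree (T B) \<le> d" by (auto intro!: degree_le simp: coeff_T)
  then have degs: "degree (T A) = d" using le_degree[OF aT] by simp
  have b0: "coeff (T B) 0 \<noteq> 0" using Bd mu by (simp add: coeff_T)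
  have even: "coeff (T B) i = 0" if "odd i" for i
    using that \<open>odd d\<close> B_odd[of "d - i"] by (auto simp: coeff_T)
  have odd: "coeff (T A) i = 0" if "even i" for i
    using that \<open>odd d\<close> A_even[of "d - i"] by (auto simp: coeff_T)
  have "degree (T B) \<noteq> d"
    using even[OF \<open>odd d\<close>] b0 by (metis coeff_0 leading_coeff_0_iff)
  then have "degree (T B) < d" using \<open>degree (T B) \<le> d\<close> by simp
  have "T A \<noteq> 0" using aT by auto
  note * = odd_even_pencil_inequality[OF nv' odd even degs this \<open>degree (T B) < d\<close> b0]
  have d: "Suc 0 \<le> d" "d - (d - Suc 0) = Suc 0" using \<open>odd d\<close> by (cases d; simp)+
  show nz: "coeff A (d - 1) \<noteq> 0" "coeff B 1 \<noteq> 0"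
    using *(1,2) d mu by (auto simp: coeff_T split: if_splits)
  show "leading_exponent (coeff A 0) + leading_exponent (coeff B d)
      \<le> leading_exponent (coeff A (d - 1)) + leading_exponent (coeff B 1)"
    using *(3) d mu nz A0 Bd by (simp add: coeff_T leading_exponent_mult)
qed


section \<open>Exchange for multiaffine polynomials\<close>

text \<open>The strict bound nu(x) < k, valid for 0 as well, so that vanishing coefficients need no
  separate treatment in sums.\<close>

definition exps_lt :: "'a::zero puiseux \<Rightarrow> real \<Rightarrow> bool"
  where "exps_lt x k \<longleftrightarrow> (\<forall>j\<ge>k. pcoeff x j = 0)"

lemma exps_lt_0 [simp]: "exps_lt (0 :: 'a::comm_ring_1 puiseux) k"
  by (simp add: exps_lt_def zero_puiseux.rep_eq)

lemma exps_lt_iff: "x \<noteq> 0 \<Longrightarrow> exps_lt x k \<longleftrightarrow> leading_exponent x < k"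
  for x :: "'a::comm_ring_1 puiseux"
  using leading_exponent_props[of x] unfolding exps_lt_def
  by (metis linorder_not_less order_less_le_trans)

lemma exps_lt_sum: "(\<And>i. i \<in> I \<Longrightarrow> exps_lt (f i) k) \<Longrightarrow> exps_lt (sum f I) k"
  for f :: "'i \<Rightarrow> 'a::comm_ring_1 puiseux"
  by (simp add: exps_lt_def pcoeff_sum)

lemma exps_lt_times_pmono:
  fixes x :: "'a::idom puiseux"
  assumes "x \<noteq> 0 \<Longrightarrow> leading_exponent x + k < b"
  shows "exps_lt (x * pmono 1 k) b"
  using assms by (cases "x = 0") (auto simp: exps_lt_iff leading_exponent_mult)

lemma prod_pmono: "(\<Prod>i\<in>I. pmono 1 (v i)) = (pmono 1 (\<Sum>i\<in>I. v i) :: 'a::comm_ring_1 puiseux)"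
  by (induction I rule: infinite_finite_induct) (simp_all add: pconst_1 pmono_mult)

lemma pIm_pmono_times_pos: "0 < pIm (pmono 1 k * x) \<longleftrightarrow> 0 < pIm x"
proof -
  have "pIm (pmono 1 k * x) = pmono 1 k * pIm x"
    by (rule puiseux_eqI) (simp add: pIm.rep_eq pcoeff_pmono_times)
  moreover have "0 < (pmono 1 k :: real puiseux)" by (simp add: less_puiseux_def)
  ultimately show ?thesis by (auto simp: zero_less_mult_iff)
qed

definition multiaffine_stable :: "'e set \<Rightarrow> ('e set \<Rightarrow> complex puiseux) \<Rightarrow> bool"
  where "multiaffine_stable E c \<longleftrightarrow>
    (\<forall>Z. (\<forall>e\<in>E. 0 < pIm (Z e)) \<longrightarrow> (\<Sum>S\<in>Pow E. c S * (\<Prod>e\<in>S. Z e)) \<noteq> 0)"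

text \<open>If every exchange fails, weights \<open>v\<close> can be chosen such that substituting \<open>t\<^sup>v\<^sup>(\<^sup>f\<^sup>) x\<close> for the
  variables other than \<open>e\<close> violates the inequality for the resulting pencil in \<open>x\<close>. The variables outside
  \<open>B\<close> get a weight so small that they do not matter.\<close>

lemma multiaffine_exchange_empty:
  fixes c :: "'e set \<Rightarrow> complex puiseux"
  assumes fin: "finite E" and stable: "multiaffine_stable E c"
    and parity: "\<And>S. S \<subseteq> E \<Longrightarrow> c S \<noteq> 0 \<Longrightarrow> even (card S)"
    and c0: "c {} \<noteq> 0" and B: "B \<subseteq> E" "c B \<noteq> 0" and e: "e \<in> B"
  shows "\<exists>f\<in>B - {e}. c {e, f} \<noteq> 0 \<and> c (B - {e, f}) \<noteq> 0 \<and>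
    leading_exponent (c {}) + leading_exponent (c B)
      \<le> leading_exponent (c {e, f}) + leading_exponent (c (B - {e, f}))"
proof (rule ccontr)
  define l where "l S = leading_exponent (c S)" for S
  define M where "M = l {} + l B"
  assume "\<not> ?thesis"
  then have fail: "l {e, f} + l (B - {e, f}) < M"
    if "f \<in> B - {e}" "c {e, f} \<noteq> 0" "c (B - {e, f}) \<noteq> 0" for f
    using that unfolding M_def l_def by force
  \<comment> \<open>The aim is nu(Q_1) < 0 and nu(A_(d-1)) < M + U, where U is the sum of all u f,
    while nu(A_0) + nu(Q_d) = M + U. The two conditions put u f below \<open>- l {e, f}\<close> and
    above \<open>l (B - {e, f}) - M\<close>; failure of the exchange says exactly that this interval
    is nonempty, or that one end is absent because a coefficient vanishes.\<close>
  have "\<exists>u. (c {e, f} \<noteq> 0 \<longrightarrow> l {e, f} + u < 0) \<and> (c (B - {e, f}) \<noteq> 0 \<longrightarrow> l (B - {e, f}) - u < M)"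
    if f: "f \<in> B - {e}" for f
  proof -
    let ?x = "l (B - {e, f}) - M" and ?y = "- l {e, f}"
    consider "c {e, f} = 0" | "c (B - {e, f}) = 0" | "?x < ?y" using fail[OF f] by argo
    then show ?thesis
    proof cases
      case 1 then show ?thesis by (intro exI[of _ "?x + 1"]) auto
    next
      case 2 then show ?thesis by (intro exI[of _ "?y - 1"]) auto
    next
      case 3
      then obtain u where "?x < u" "u < ?y" using dense by blast
      then show ?thesis by (intro exI[of _ u]) auto
    qed
  qed
  then obtain u where u: "\<And>f. f \<in> B - {e} \<Longrightarrow> c {e, f} \<noteq> 0 \<Longrightarrow> l {e, f} + u f < 0"
      "\<And>f. f \<in> B - {e} \<Longrightarrow> c (B - {e, f}) \<noteq> 0 \<Longrightarrow> l (B - {e, f}) - u f < M"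
    by metis
  define L where "L = (\<Sum>S\<in>Pow E. \<bar>l S\<bar>)"
  define W where "W = (\<Sum>f\<in>B - {e}. \<bar>u f\<bar>)"
  define U where "U = (\<Sum>f\<in>B - {e}. u f)"
  \<comment> \<open>A set that leaves B has weight at most W - N. The most demanding use is L + W -
    N < -2 L - W, for A_(d-1), and N exceeds 3 L + 2 W.\<close>
  define N where "N = 1 + 4 * L + 2 * W"
  define v where "v f = (if f \<in> B then u f else - N)" for f
  define F where "F = E - {e}"
  have F: "finite F" "e \<notin> F" "E = insert e F" using fin B(1) e by (auto simp: F_def)
  have finB: "finite B" using B(1) fin finite_subset by blast
  have L: "\<bar>l S\<bar> \<le> L" if "S \<subseteq> E" for S
    unfolding L_def using that fin by (intro member_le_sum) auto
  have "0 \<le> L" using L[of "{}"] by simp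
  have "0 \<le> W" by (simp add: W_def sum_nonneg)
  have "\<bar>U\<bar> \<le> W" unfolding U_def W_def by (rule sum_abs)
  have M: "\<bar>M\<bar> \<le> 2 * L" using L[of "{}"] L[of B] B(1) by (simp add: M_def)
  have far: "(\<Sum>f\<in>S. v f) \<le> W - N" if S: "S \<subseteq> F" "\<not> S \<subseteq> B" for S
  proof -
    have finS: "finite S" using S F finite_subset by blast
    have "(\<Sum>f\<in>S. v f) = (\<Sum>f\<in>S \<inter> B. v f) + (\<Sum>f\<in>S - B. v f)"
      using finS by (rule sum.Int_Diff)
    also have "(\<Sum>f\<in>S \<inter> B. v f) \<le> (\<Sum>f\<in>S \<inter> B. \<bar>u f\<bar>)"
      by (intro sum_mono) (auto simp: v_def)
    also have "\<dots> \<le> W"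
      unfolding W_def using S(1) F(2) finB by (intro sum_mono2) auto
    also have "(\<Sum>f\<in>S - B. v f) = - (real (card (S - B)) * N)"
      by (simp add: v_def)
    also have "\<dots> \<le> - (1 * N)"
    proof -
      have "card (S - B) \<noteq> 0" using S(2) finS by auto
      then have "1 * N \<le> real (card (S - B)) * N"
        using \<open>0 \<le> L\<close> \<open>0 \<le> W\<close> by (intro mult_right_mono) (auto simp: N_def)
      then show ?thesis by simp
    qed
    finally show ?thesis by simp
  qed
  have vB: "(\<Sum>f\<in>S. v f) = (\<Sum>f\<in>S. u f)" if "S \<subseteq> B" for S
    using that by (intro sum.cong) (auto simp: v_def)

  define x where "x S = c S * pmono 1 (\<Sum>f\<in>S. v f)" for S
  define y where "y S = c (insert e S) * pmono 1 (\<Sum>f\<in>S. v f)" for S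
  define A where "A = (\<Sum>S\<in>Pow F. monom (x S) (card S))"
  define Q where "Q = (\<Sum>S\<in>Pow F. monom (y S) (card S))"
  have coeff_A: "coeff A i = (\<Sum>S | S \<in> Pow F \<and> card S = i. x S)" for i
    using F(1) by (simp add: A_def coeff_sum sum.inter_filter[symmetric])
  have coeff_Q: "coeff Q i = (\<Sum>S | S \<in> Pow F \<and> card S = i. y S)" for i
    using F(1) by (simp add: Q_def coeff_sum sum.inter_filter[symmetric])
  have nv: "poly A z + w * poly Q z \<noteq> 0" if z: "0 < pIm z" and w: "0 < pIm w" for z w
  proof -
    define Z where "Z f = (if f = e then w else pmono 1 (v f) * z)" for f
    have prod: "(\<Prod>f\<in>S. Z f) = pmono 1 (\<Sum>f\<in>S. v f) * z ^ card S" if "S \<in> Pow F" for S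
    proof -
      have "(\<Prod>f\<in>S. Z f) = (\<Prod>f\<in>S. pmono 1 (v f) * z)"
        using that F(2) by (intro prod.cong) (auto simp: Z_def)
      then show ?thesis by (simp add: prod.distrib prod_pmono)
    qed
    have "c S * (\<Prod>f\<in>S. Z f) + c (insert e S) * (\<Prod>f\<in>insert e S. Z f) =
        x S * z ^ card S + w * (y S * z ^ card S)" if S: "S \<in> Pow F" for S
    proof -
      have "finite S" "e \<notin> S" using S F finite_subset by auto
      then have "(\<Prod>f\<in>insert e S. Z f) = w * (\<Prod>f\<in>S. Z f)" by (simp add: Z_def)
      then show ?thesis unfolding prod[OF S] x_def y_def by (simp add: mult_ac)
    qed
    then have "(\<Sum>S\<in>Pow E. c S * (\<Prod>f\<in>S. Z f)) = poly A z + w * poly Q z"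
      unfolding F(3) sum_Pow_insert[OF F(1,2)]
      by (simp add: A_def Q_def poly_sum poly_monom sum.distrib sum_distrib_left)
    moreover have "\<forall>f\<in>E. 0 < pIm (Z f)" using z w by (simp add: Z_def pIm_pmono_times_pos)
    ultimately show ?thesis using stable unfolding multiaffine_stable_def by metis
  qed
  have A_even: "coeff A i = 0" if "odd i" for i
    unfolding coeff_A using parity that F by (intro sum.neutral) (auto simp: x_def)
  have Q_odd: "coeff Q i = 0" if "even i" for i
    unfolding coeff_Q
  proof (intro sum.neutral ballI)
    fix S assume "S \<in> {S \<in> Pow F. card S = i}"
    then have S: "S \<subseteq> F" "card S = i" by auto
    then have "finite S" "e \<notin> S" using F finite_subset by auto
    then have "odd (card (insert e S))" using S that by simp
    then show "y S = 0" using parity[of "insert e S"] S F by (auto simp: y_def)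
  qed
  have "{S \<in> Pow F. card S = 0} = {{}}" using F(1) finite_subset by fastforce
  then have A0: "coeff A 0 = c {}" by (simp add: coeff_A x_def pconst_1)

  define d where "d = card B - 1"
  have card: "card (B - {e}) = d" "B - {e} \<in> Pow F" "insert e (B - {e}) = B"
    using finB e B(1) by (auto simp: d_def F_def)
  have yB: "y (B - {e}) = c B * pmono 1 U"
    using card(3) vB[of "B - {e}"] by (auto simp: y_def U_def)
  have lB: "leading_exponent (y (B - {e})) = l B + U" "y (B - {e}) \<noteq> 0"
    using B(2) by (simp_all add: yB leading_exponent_mult l_def)
  \<comment> \<open>Among the d-element subsets of F only \<open>B - {e}\<close> lies inside B. All
    others carry some weight -N, so they cannot cancel the leading term of Q_d.\<close>
  have Q_rest: "exps_lt (\<Sum>S\<in>{S \<in> Pow F. card S = d} - {B - {e}}. y S) (l B + U)"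
  proof (rule exps_lt_sum)
    fix S assume "S \<in> {S \<in> Pow F. card S = d} - {B - {e}}"
    then have S: "S \<subseteq> F" "card S = d" "S \<noteq> B - {e}" by auto
    have "\<not> S \<subseteq> B"
    proof
      assume "S \<subseteq> B"
      then have "S \<subseteq> B - {e}" using S(1) F(2) by auto
      then show False using S(2,3) card finB by (metis card_subset_eq finite_Diff)
    qed
    then have "(\<Sum>f\<in>S. v f) \<le> W - N" using far S(1) by blast
    moreover have "\<bar>l (insert e S)\<bar> \<le> L" "\<bar>l B\<bar> \<le> L"
      using L[of "insert e S"] L[of B] S(1) F(3) B(1) by auto
    ultimately show "exps_lt (y S) (l B + U)"
      unfolding y_def using \<open>\<bar>U\<bar> \<le> W\<close> \<open>0 \<le> L\<close>
      by (intro exps_lt_times_pmono) (simp add: l_def[symmetric] N_def)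
  qed
  have "coeff Q d = y (B - {e}) + (\<Sum>S\<in>{S \<in> Pow F. card S = d} - {B - {e}}. y S)"
    unfolding coeff_Q using card F(1) by (intro sum.remove) auto
  then have "exps_le (coeff Q d) (l B + U)" "pcoeff (coeff Q d) (l B + U) \<noteq> 0"
    using Q_rest exps_le_leading_exponent[OF lB(2)] pcoeff_leading_exponent[OF lB(2)] lB(1)
    by (auto simp: plus_puiseux.rep_eq exps_le_def exps_lt_def)
  note Qd = leading_exponent_eqI(1,2)[OF this]
  note ineq = even_odd_pencil_inequality[OF nv A_even Q_odd _ Qd(1), unfolded A0, OF _ _ _ _ c0]

  have "exps_lt (coeff Q 1) 0"
    unfolding coeff_Q
  proof (rule exps_lt_sum)
    fix S assume "S \<in> {S \<in> Pow F. card S = 1}"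
    then obtain f where f: "S = {f}" "f \<in> F" by (auto simp: card_1_singleton_iff)
    show "exps_lt (y S) 0"
      unfolding y_def
    proof (rule exps_lt_times_pmono)
      assume nz: "c (insert e S) \<noteq> 0"
      show "leading_exponent (c (insert e S)) + (\<Sum>f\<in>S. v f) < 0"
      proof (cases "f \<in> B")
        case True
        then show ?thesis using u(1)[of f] nz f F(2) by (auto simp: l_def v_def)
      next
        case False
        then show ?thesis
          using L[of "{e, f}"] f F \<open>0 \<le> L\<close> \<open>0 \<le> W\<close> by (simp add: l_def v_def N_def)
      qed
    qed
  qed
  moreover have "exps_lt (coeff A (d - 1)) (M + U)"
    unfolding coeff_A
  proof (rule exps_lt_sum)
    fix S assume "S \<in> {S \<in> Pow F. card S = d - 1}"
    then have S: "S \<subseteq> F" "card S = d - 1" by auto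
    show "exps_lt (x S) (M + U)"
      unfolding x_def
    proof (rule exps_lt_times_pmono)
      assume nz: "c S \<noteq> 0"
      show "leading_exponent (c S) + (\<Sum>f\<in>S. v f) < M + U"
      proof (cases "S \<subseteq> B")
        case True
        then have SB: "S \<subseteq> B - {e}" using S(1) F(2) by auto
        \<comment> \<open>B is nonempty of even size, so d is odd, \<open>d - 1\<close> is not
          truncated, and S omits exactly one element f of \<open>B - {e}\<close>.\<close>
        have "even (card B)" "card B \<noteq> 0" using parity B finB e by auto
        then have "1 \<le> d" by (auto simp: d_def elim!: evenE)
        have "card (B - {e} - S) = card (B - {e}) - card S"
          using SB finB finite_subset by (intro card_Diff_subset) auto
        then have "card (B - {e} - S) = 1" using S(2) \<open>1 \<le> d\<close> card(1) by simp
        then obtain f where "B - {e} - S = {f}" by (auto simp: card_1_singleton_iff)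
        then have f: "f \<in> B - {e}" "S = B - {e, f}" using SB by auto
        have "(\<Sum>g\<in>S. v g) = (\<Sum>g\<in>B - {e} - {f}. u g)"
          using vB[OF True] f(2) by (simp add: Diff_insert2[symmetric] insert_commute)
        also have "\<dots> = U - u f"
          unfolding U_def using f(1) finB by (subst sum_diff1) auto
        finally show ?thesis using u(2)[OF f(1)] nz f(2) by (simp add: l_def)
      next
        case False
        then have "(\<Sum>f\<in>S. v f) \<le> W - N" using far S(1) by blast
        moreover have "\<bar>l S\<bar> \<le> L" using L S(1) F by auto
        ultimately show ?thesis
          using M \<open>\<bar>U\<bar> \<le> W\<close> \<open>0 \<le> L\<close> by (simp add: l_def[symmetric] N_def)
      qed
    qed
  qed
  ultimately show False
    using ineq Qd(2) by (simp add: exps_lt_iff l_def M_def)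
qed

lemma card_sym_diff:
  assumes "finite S" "finite A"
  shows "card (sym_diff S A) + 2 * card (S \<inter> A) = card S + card A"
proof -
  have "card (sym_diff S A) = card (S - A) + card (A - S)"
    using assms by (intro card_Un_disjoint) auto
  moreover have "card S = card (S \<inter> A) + card (S - A)" "card A = card (S \<inter> A) + card (A - S)"
    using assms by (metis card_Int_Diff, metis card_Int_Diff Int_commute)
  ultimately show ?thesis by simp
qed

text \<open>Substituting \<open>- 1 / z\<^sub>e\<close> for the variables \<open>e \<in> A\<close> moves \<open>A\<close> to the empty set.\<close>

lemma multiaffine_stable_reflect:
  fixes c :: "'e set \<Rightarrow> complex puiseux"
  assumes fin: "finite E" and stable: "multiaffine_stable E c" and A: "A \<subseteq> E"
  shows "multiaffine_stable E (\<lambda>S. (- 1) ^ card (A - S) * c (sym_diff S A))"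
  unfolding multiaffine_stable_def
proof (intro allI impI)
  fix Z :: "'e \<Rightarrow> complex puiseux" assume Z: "\<forall>e\<in>E. 0 < pIm (Z e)"
  define Y where "Y e = (if e \<in> A then pinverse (- Z e) else Z e)" for e
  have nz: "Z e \<noteq> 0" if "e \<in> E" for e using Z that by auto
  have Y: "0 < pIm (Y e)" if "e \<in> E" for e
    using Z[rule_format, OF that] nz[OF that] by (simp add: Y_def pIm_pinverse_sign)
  \<comment> \<open>The product over A clears the denominators: a variable in both S and A
    contributes z (-1/z) = -1, one in \<open>A - S\<close> is left over.\<close>
  have term_eq: "(\<Prod>e\<in>A. Z e) * (\<Prod>e\<in>S. Y e) = (- 1) ^ card (S \<inter> A) * (\<Prod>e\<in>sym_diff S A. Z e)"
    if S: "S \<subseteq> E" for S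
  proof -
    have fins: "finite S" "finite A" using S A fin finite_subset by blast+
    have "(\<Prod>e\<in>A. Z e) = (\<Prod>e\<in>S \<inter> A. Z e) * (\<Prod>e\<in>A - S. Z e)"
      using prod.Int_Diff[OF fins(2), of Z S] by (simp add: Int_commute)
    moreover have "(\<Prod>e\<in>S. Y e) = (\<Prod>e\<in>S \<inter> A. Y e) * (\<Prod>e\<in>S - A. Y e)"
      by (rule prod.Int_Diff[OF fins(1)])
    moreover have "(\<Prod>e\<in>S - A. Y e) = (\<Prod>e\<in>S - A. Z e)"
      by (intro prod.cong) (auto simp: Y_def)
    moreover have "(\<Prod>e\<in>S \<inter> A. Z e) * (\<Prod>e\<in>S \<inter> A. Y e) = (\<Prod>e\<in>S \<inter> A. - 1)"
      unfolding prod.distrib[symmetric]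
    proof (intro prod.cong refl)
      fix e assume e: "e \<in> S \<inter> A"
      then have "- Z e \<noteq> 0" using nz S by auto
      from mult_pinverse[OF this] show "Z e * Y e = - 1"
        using e by (simp add: Y_def minus_equation_iff[of _ 1] minus_mult_left[symmetric])
    qed
    moreover have "(\<Prod>e\<in>sym_diff S A. Z e) = (\<Prod>e\<in>S - A. Z e) * (\<Prod>e\<in>A - S. Z e)"
      using fins by (intro prod.union_disjoint) auto
    ultimately show ?thesis by (simp add: mult_ac)
  qed
  have inv: "sym_diff (sym_diff S A) A = S" for S by auto
  have "(\<Sum>S\<in>Pow E. (- 1) ^ card (A - S) * c (sym_diff S A) * (\<Prod>e\<in>S. Z e)) =
      (\<Sum>S\<in>Pow E. (\<Prod>e\<in>A. Z e) * (c S * (\<Prod>e\<in>S. Y e)))"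
  proof (rule sum.reindex_bij_witness[of _ "\<lambda>S. sym_diff S A" "\<lambda>S. sym_diff S A"])
    fix S assume S: "S \<in> Pow E"
    then have S': "sym_diff S A \<subseteq> E" using A by auto
    have "sym_diff S A \<inter> A = A - S" by auto
    with term_eq[OF S'] show "(\<Prod>e\<in>A. Z e) * (c (sym_diff S A) * (\<Prod>e\<in>sym_diff S A. Y e)) =
        (- 1) ^ card (A - S) * c (sym_diff S A) * (\<Prod>e\<in>S. Z e)"
      unfolding inv mult.left_commute[of "prod Z A"] by (simp add: mult_ac)
  qed (use A in auto)
  also have "\<dots> = (\<Prod>e\<in>A. Z e) * (\<Sum>S\<in>Pow E. c S * (\<Prod>e\<in>S. Y e))"
    by (simp add: sum_distrib_left)
  also have "\<dots> \<noteq> 0"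
  proof -
    have "(\<Prod>e\<in>A. Z e) \<noteq> 0" using nz A finite_subset[OF A fin] by (auto simp: prod_zero_iff)
    then show ?thesis using stable Y unfolding multiaffine_stable_def by auto
  qed
  finally show "(\<Sum>S\<in>Pow E. (- 1) ^ card (A - S) * c (sym_diff S A) * (\<Prod>e\<in>S. Z e)) \<noteq> 0" .
qed

text \<open>Reflection in A relabels S as \<open>sym_diff S A\<close> up to a sign, which does not
  affect exponents, and so reduces to the case of the empty set. A itself may have odd size, but the
  reflected coefficients live on even sets, because the size of \<open>sym_diff S A\<close> has the
  parity of |S| + |A|.\<close>

lemma multiaffine_exchange:
  fixes c :: "'e set \<Rightarrow> complex puiseux"
  assumes fin: "finite E" and stable: "multiaffine_stable E c"
    and parity: "\<And>S T. S \<subseteq> E \<Longrightarrow> T \<subseteq> E \<Longrightarrow> c S \<noteq> 0 \<Longrightarrow> c T \<noteq> 0 \<Longrightarrow> even (card S) = even (card T)"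
    and A: "A \<subseteq> E" "c A \<noteq> 0" and B: "B \<subseteq> E" "c B \<noteq> 0" and e: "e \<in> sym_diff A B"
  obtains f where "f \<in> sym_diff A B" "f \<noteq> e"
    "c (sym_diff A {e, f}) \<noteq> 0" "c (sym_diff B {e, f}) \<noteq> 0"
    "leading_exponent (c A) + leading_exponent (c B)
      \<le> leading_exponent (c (sym_diff A {e, f})) + leading_exponent (c (sym_diff B {e, f}))"
proof -
  define c' where "c' S = (- 1) ^ card (A - S) * c (sym_diff S A)" for S
  have c'_nz: "c' S \<noteq> 0 \<longleftrightarrow> c (sym_diff S A) \<noteq> 0" for S by (simp add: c'_def)
  have c'_le: "leading_exponent (c' S) = leading_exponent (c (sym_diff S A))" for S
    by (cases "even (card (A - S))") (simp_all add: c'_def)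
  have s1: "sym_diff {} A = A" "sym_diff (sym_diff A B) A = B" by auto
  have s2: "sym_diff {e, f} A = sym_diff A {e, f}" for f by auto
  have s3: "sym_diff (sym_diff A B - {e, f}) A = sym_diff B {e, f}" if "f \<in> sym_diff A B" for f
    using that e by auto
  have "\<exists>f\<in>sym_diff A B - {e}. c' {e, f} \<noteq> 0 \<and> c' (sym_diff A B - {e, f}) \<noteq> 0 \<and>
    leading_exponent (c' {}) + leading_exponent (c' (sym_diff A B))
      \<le> leading_exponent (c' {e, f}) + leading_exponent (c' (sym_diff A B - {e, f}))"
  proof (rule multiaffine_exchange_empty[OF fin])
    show "multiaffine_stable E c'"
      unfolding c'_def by (rule multiaffine_stable_reflect[OF fin stable A(1)])
    show "even (card S)" if S: "S \<subseteq> E" "c' S \<noteq> 0" for S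
    proof -
      have fins: "finite S" "finite A" using S A fin finite_subset by blast+
      have "sym_diff S A \<subseteq> E" using S A by auto
      then have "even (card (sym_diff S A)) = even (card A)"
        using parity A S c'_nz by blast
      moreover have "even (card (sym_diff S A) + 2 * card (S \<inter> A)) = even (card S + card A)"
        by (simp only: card_sym_diff[OF fins])
      ultimately show ?thesis by auto
    qed
  qed (use A B e in \<open>auto simp: c'_nz s1\<close>)
  then obtain f where f: "f \<in> sym_diff A B - {e}" "c' {e, f} \<noteq> 0" "c' (sym_diff A B - {e, f}) \<noteq> 0"
    "leading_exponent (c' {}) + leading_exponent (c' (sym_diff A B))
      \<le> leading_exponent (c' {e, f}) + leading_exponent (c' (sym_diff A B - {e, f}))"
    by blast
  then have f': "f \<in> sym_diff A B" "f \<noteq> e" by auto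
  show thesis
    by (rule that[OF f']) (use f in \<open>simp_all only: c'_nz c'_le s1 s2 s3[OF f'(1)] not_False_eq_True\<close>)
qed


section \<open>Polarization and M-concavity\<close>

lemma prod_pconst: "(\<Prod>i\<in>I. pconst (f i)) = (pconst (\<Prod>i\<in>I. f i) :: 'a::comm_ring_1 puiseux)"
  by (induction I rule: infinite_finite_induct) (simp_all add: pconst_1 pmono_mult)

lemma times_pconst_nz:
  fixes x :: "'a::idom puiseux"
  assumes "c \<noteq> 0"
  shows "x * pconst c \<noteq> 0 \<longleftrightarrow> x \<noteq> 0" "leading_exponent (x * pconst c) = leading_exponent x"
  using assms by (auto, cases "x = 0") (simp_all add: leading_exponent_mult)

text \<open>The pair \<open>(j, i)\<close> stands for the \<open>i\<close>-th copy of the variable \<open>z\<^sub>j\<close>.\<close>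

definition fibre_card :: "('n::finite \<times> nat) set \<Rightarrow> nat ^ 'n"
  where "fibre_card S = (\<chi> j. card {i. (j, i) \<in> S})"

text \<open>\<open>L j i\<close> is the i-th elementary symmetric polynomial of the k copies of
  variable j, divided by C(k,i). The variables are polarized one at a time: with all others fixed,
  polarized or not, the sum is a polynomial of degree at most k in the next variable, to which
  Grace--Walsh--Szego applies.\<close>

lemma partial_polarization_nonzero:
  fixes a :: "nat ^ 'n \<Rightarrow> complex puiseux" and Z :: "'n \<Rightarrow> nat \<Rightarrow> complex puiseux"
  assumes fin: "finite \<Gamma>" and bound: "\<And>\<gamma> j. \<gamma> \<in> \<Gamma> \<Longrightarrow> \<gamma> $ j \<le> k"
    and nv: "\<And>z. (\<And>j. 0 < pIm (z j)) \<Longrightarrow> (\<Sum>\<gamma>\<in>\<Gamma>. a \<gamma> * (\<Prod>j\<in>UNIV. z j ^ (\<gamma> $ j))) \<noteq> 0"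
    and Z: "\<And>j i. i < k \<Longrightarrow> 0 < pIm (Z j i)" and z: "\<And>j. 0 < pIm (z j)"
    and L: "\<And>j i. L j i = (\<Sum>T\<in>Pow {..<k}.
        if card T = i then pconst (1 / of_nat (k choose card T)) * (\<Prod>m\<in>T. Z j m) else 0)"
  shows "(\<Sum>\<gamma>\<in>\<Gamma>. a \<gamma> * (\<Prod>j\<in>UNIV. if j \<in> J then L j (\<gamma> $ j) else z j ^ (\<gamma> $ j))) \<noteq> 0"
proof -
  have "finite J" by simp
  then show ?thesis using z
  proof (induction J arbitrary: z rule: finite_induct)
    case empty
    then show ?case using nv by simp
  next
    case (insert j0 J)
    define r where "r \<gamma> = a \<gamma> * (\<Prod>j\<in>UNIV - {j0}. if j \<in> J then L j (\<gamma> $ j) else z j ^ (\<gamma> $ j))" for \<gamma>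
    define p where "p = (\<Sum>\<gamma>\<in>\<Gamma>. monom (r \<gamma>) (\<gamma> $ j0))"
    have coeff_p: "coeff p i = (\<Sum>\<gamma>\<in>\<Gamma>. if \<gamma> $ j0 = i then r \<gamma> else 0)" for i
      by (simp add: p_def coeff_sum)
    have "poly p x \<noteq> 0" if x: "0 < pIm x" for x
    proof -
      define z' where "z' = z(j0 := x)"
      have "a \<gamma> * (\<Prod>j\<in>UNIV. if j \<in> J then L j (\<gamma> $ j) else z' j ^ (\<gamma> $ j)) = r \<gamma> * x ^ (\<gamma> $ j0)" for \<gamma>
      proof -
        have "(\<Prod>j\<in>UNIV. if j \<in> J then L j (\<gamma> $ j) else z' j ^ (\<gamma> $ j)) =
            x ^ (\<gamma> $ j0) * (\<Prod>j\<in>UNIV - {j0}. if j \<in> J then L j (\<gamma> $ j) else z' j ^ (\<gamma> $ j))"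
          using insert.hyps by (subst prod.remove[of _ j0]) (auto simp: z'_def)
        also have "(\<Prod>j\<in>UNIV - {j0}. if j \<in> J then L j (\<gamma> $ j) else z' j ^ (\<gamma> $ j)) =
            (\<Prod>j\<in>UNIV - {j0}. if j \<in> J then L j (\<gamma> $ j) else z j ^ (\<gamma> $ j))"
          by (intro prod.cong) (auto simp: z'_def)
        finally show ?thesis by (simp add: r_def mult_ac)
      qed
      moreover have "0 < pIm (z' j)" for j using insert.prems x by (simp add: z'_def)
      ultimately show ?thesis
        using insert.IH[of z'] by (simp add: p_def poly_sum poly_monom)
    qed
    moreover have "degree p \<le> card {..<k}"
      unfolding p_def using bound by (intro degree_sum_le[OF fin]) (auto intro: order_trans[OF degree_monom_le])
    ultimately have "(\<Sum>T\<in>Pow {..<k}. coeff p (card T) * pconst (1 / of_nat (card {..<k} choose card T)) * (\<Prod>m\<in>T. Z j0 m)) \<noteq> 0"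
      using Z by (intro grace_walsh_szego) auto
    also have "(\<Sum>T\<in>Pow {..<k}. coeff p (card T) * pconst (1 / of_nat (card {..<k} choose card T)) * (\<Prod>m\<in>T. Z j0 m)) =
        (\<Sum>T\<in>Pow {..<k}. \<Sum>\<gamma>\<in>\<Gamma>. r \<gamma> *
          (if card T = \<gamma> $ j0 then pconst (1 / of_nat (k choose card T)) * (\<Prod>m\<in>T. Z j0 m) else 0))"
      unfolding coeff_p sum_distrib_right by (intro sum.cong refl) (auto simp: mult.assoc)
    also have "\<dots> = (\<Sum>\<gamma>\<in>\<Gamma>. r \<gamma> * L j0 (\<gamma> $ j0))"
      unfolding L sum_distrib_left by (rule sum.swap)
    also have "\<dots> = (\<Sum>\<gamma>\<in>\<Gamma>. a \<gamma> * (\<Prod>j\<in>UNIV. if j \<in> insert j0 J then L j (\<gamma> $ j) else z j ^ (\<gamma> $ j)))"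
    proof (intro sum.cong refl)
      fix \<gamma>
      have "(\<Prod>j\<in>UNIV. if j \<in> insert j0 J then L j (\<gamma> $ j) else z j ^ (\<gamma> $ j)) =
          L j0 (\<gamma> $ j0) * (\<Prod>j\<in>UNIV - {j0}. if j \<in> insert j0 J then L j (\<gamma> $ j) else z j ^ (\<gamma> $ j))"
        by (subst prod.remove[of _ j0]) auto
      also have "(\<Prod>j\<in>UNIV - {j0}. if j \<in> insert j0 J then L j (\<gamma> $ j) else z j ^ (\<gamma> $ j)) =
          (\<Prod>j\<in>UNIV - {j0}. if j \<in> J then L j (\<gamma> $ j) else z j ^ (\<gamma> $ j))"
        by (intro prod.cong) auto
      finally show "r \<gamma> * L j0 (\<gamma> $ j0) =
          a \<gamma> * (\<Prod>j\<in>UNIV. if j \<in> insert j0 J then L j (\<gamma> $ j) else z j ^ (\<gamma> $ j))"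
        by (simp add: r_def mult_ac)
    qed
    finally show ?case .
  qed
qed

text \<open>Expanding the product of the symmetric polynomials gives a sum over families of subsets
  of \<open>{..<k}\<close>, one for each variable. These families are the subsets of
  \<open>UNIV \<times> {..<k}\<close>, and only the exponent vector of their sizes survives.\<close>

lemma polarization_stable:
  fixes a :: "nat ^ 'n::finite \<Rightarrow> complex puiseux"
  assumes fin: "finite {\<gamma>. a \<gamma> \<noteq> 0}" and bound: "\<And>\<gamma> j. a \<gamma> \<noteq> 0 \<Longrightarrow> \<gamma> $ j \<le> k"
    and nv: "\<And>z. (\<And>j. 0 < pIm (z j)) \<Longrightarrow> (\<Sum>\<gamma> | a \<gamma> \<noteq> 0. a \<gamma> * (\<Prod>j\<in>UNIV. z j ^ (\<gamma> $ j))) \<noteq> 0"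
  shows "multiaffine_stable (UNIV \<times> {..<k})
    (\<lambda>S. a (fibre_card S) * pconst (\<Prod>j\<in>UNIV. 1 / of_nat (k choose fibre_card S $ j)))"
  unfolding multiaffine_stable_def
proof (intro allI impI)
  fix Z :: "'n \<times> nat \<Rightarrow> complex puiseux"
  assume Z: "\<forall>e\<in>UNIV \<times> {..<k}. 0 < pIm (Z e)"
  define h where "h j T = pconst (1 / of_nat (k choose card T)) * (\<Prod>m\<in>T. Z (j, m))" for j T
  define L where "L j i = (\<Sum>T\<in>Pow {..<k}. if card T = i then h j T else 0)" for j i
  let ?\<Gamma> = "{\<gamma>. a \<gamma> \<noteq> 0}" and ?\<Pi> = "PiE UNIV (\<lambda>_. Pow {..<k}) :: ('n \<Rightarrow> nat set) set"
  \<comment> \<open>Here all variables are polarized; \<open>pmono \<i> 0\<close> merely witnesses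
    that the half-plane is nonempty.\<close>
  have "(\<Sum>\<gamma>\<in>?\<Gamma>. a \<gamma> * (\<Prod>j\<in>UNIV. if j \<in> UNIV then L j (\<gamma> $ j) else pmono \<i> 0 ^ (\<gamma> $ j))) \<noteq> 0"
    by (rule partial_polarization_nonzero[where Z = "\<lambda>j m. Z (j, m)" and k = k and z = "\<lambda>_. pmono \<i> 0"])
      (use fin bound nv Z in \<open>auto simp: L_def h_def pIm_pmono_pos cong: if_cong\<close>)
  also have "(\<Sum>\<gamma>\<in>?\<Gamma>. a \<gamma> * (\<Prod>j\<in>UNIV. if j \<in> UNIV then L j (\<gamma> $ j) else pmono \<i> 0 ^ (\<gamma> $ j))) =
      (\<Sum>\<gamma>\<in>?\<Gamma>. \<Sum>T\<in>?\<Pi>. a \<gamma> * (\<Prod>j\<in>UNIV. if card (T j) = \<gamma> $ j then h j (T j) else 0))"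
  proof (intro sum.cong refl)
    fix \<gamma>
    have "(\<Prod>j\<in>UNIV. L j (\<gamma> $ j)) = (\<Sum>T\<in>?\<Pi>. \<Prod>j\<in>UNIV. if card (T j) = \<gamma> $ j then h j (T j) else 0)"
      unfolding L_def by (rule prod_sum_PiE) auto
    then show "a \<gamma> * (\<Prod>j\<in>UNIV. if j \<in> UNIV then L j (\<gamma> $ j) else pmono \<i> 0 ^ (\<gamma> $ j)) =
        (\<Sum>T\<in>?\<Pi>. a \<gamma> * (\<Prod>j\<in>UNIV. if card (T j) = \<gamma> $ j then h j (T j) else 0))"
      by (simp add: sum_distrib_left)
  qed
  also have "\<dots> = (\<Sum>T\<in>?\<Pi>. \<Sum>\<gamma>\<in>?\<Gamma>. a \<gamma> * (\<Prod>j\<in>UNIV. if card (T j) = \<gamma> $ j then h j (T j) else 0))"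
    by (rule sum.swap)
  also have "\<dots> = (\<Sum>T\<in>?\<Pi>. a (\<chi> j. card (T j)) * (\<Prod>j\<in>UNIV. h j (T j)))"
  proof (intro sum.cong refl)
    fix T :: "'n \<Rightarrow> nat set"
    have "(\<Prod>j\<in>UNIV. if card (T j) = \<gamma> $ j then h j (T j) else 0) =
        (if \<gamma> = (\<chi> j. card (T j)) then \<Prod>j\<in>UNIV. h j (T j) else 0)" for \<gamma> :: "nat ^ 'n"
    proof (cases "\<gamma> = (\<chi> j. card (T j))")
      case False
      then obtain j where "card (T j) \<noteq> \<gamma> $ j" by (metis vec_lambda_unique)
      then have "(\<Prod>j\<in>UNIV. if card (T j) = \<gamma> $ j then h j (T j) else 0) = 0"
        by (intro prod_zero) (auto intro!: bexI[of _ j])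
      with False show ?thesis by simp
    qed simp
    then have "(\<Sum>\<gamma>\<in>?\<Gamma>. a \<gamma> * (\<Prod>j\<in>UNIV. if card (T j) = \<gamma> $ j then h j (T j) else 0)) =
        (\<Sum>\<gamma>\<in>?\<Gamma>. if \<gamma> = (\<chi> j. card (T j)) then a \<gamma> * (\<Prod>j\<in>UNIV. h j (T j)) else 0)"
      by (intro sum.cong) auto
    also have "\<dots> = a (\<chi> j. card (T j)) * (\<Prod>j\<in>UNIV. h j (T j))"
      using fin by simp
    finally show "(\<Sum>\<gamma>\<in>?\<Gamma>. a \<gamma> * (\<Prod>j\<in>UNIV. if card (T j) = \<gamma> $ j then h j (T j) else 0)) =
        a (\<chi> j. card (T j)) * (\<Prod>j\<in>UNIV. h j (T j))" .
  qed
  also have "\<dots> = (\<Sum>S\<in>Pow (UNIV \<times> {..<k}).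
      a (fibre_card S) * pconst (\<Prod>j\<in>UNIV. 1 / of_nat (k choose fibre_card S $ j)) * (\<Prod>e\<in>S. Z e))"
  proof (rule sum.reindex_bij_witness[of _ "\<lambda>S j. {i. (j, i) \<in> S}" "\<lambda>T. Sigma UNIV T"])
    fix T assume T: "T \<in> ?\<Pi>"
    then have "finite (T j)" for j by (metis PiE_mem Pow_iff UNIV_I finite_lessThan finite_subset)
    then have "(\<Prod>e\<in>Sigma UNIV T. Z e) = (\<Prod>j\<in>UNIV. \<Prod>m\<in>T j. Z (j, m))"
      by (subst prod.Sigma) auto
    moreover have "fibre_card (Sigma UNIV T) = (\<chi> j. card (T j))" by (simp add: fibre_card_def)
    ultimately show "a (fibre_card (Sigma UNIV T)) *
          pconst (\<Prod>j\<in>UNIV. 1 / of_nat (k choose fibre_card (Sigma UNIV T) $ j)) * (\<Prod>e\<in>Sigma UNIV T. Z e) =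
        a (\<chi> j. card (T j)) * (\<Prod>j\<in>UNIV. h j (T j))"
      by (simp add: h_def prod.distrib prod_pconst mult.assoc)
  qed (auto simp: PiE_iff)
  finally show "(\<Sum>S\<in>Pow (UNIV \<times> {..<k}).
      a (fibre_card S) * pconst (\<Prod>j\<in>UNIV. 1 / of_nat (k choose fibre_card S $ j)) * (\<Prod>e\<in>S. Z e)) \<noteq> 0" .
qed

section \<open>Unit steps as toggles of copies\<close>

lemma l1_add_axis: "l1 (x + axis j \<epsilon>) = l1 x - \<bar>x $ j\<bar> + \<bar>x $ j + \<epsilon>\<bar>"
proof -
  have "l1 (x + axis j \<epsilon>) = \<bar>x $ j + \<epsilon>\<bar> + (\<Sum>i\<in>UNIV - {j}. \<bar>(x + axis j \<epsilon>) $ i\<bar>)"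
    unfolding l1_def by (subst sum.remove[of _ j]) (auto simp: axis_def)
  also have "(\<Sum>i\<in>UNIV - {j}. \<bar>(x + axis j \<epsilon>) $ i\<bar>) = (\<Sum>i\<in>UNIV - {j}. \<bar>x $ i\<bar>)"
    by (intro sum.cong) (auto simp: axis_def)
  also have "\<dots> = l1 x - \<bar>x $ j\<bar>"
    unfolding l1_def by (subst (2) sum.remove[of _ j]) auto
  finally show ?thesis by simp
qed

lemma l1_eq_1E:
  assumes "l1 s = 1"
  obtains j \<epsilon> where "\<epsilon> = 1 \<or> \<epsilon> = - 1" "s = axis j \<epsilon>"
proof -
  have "\<exists>j. s $ j \<noteq> 0"
  proof (rule ccontr)
    assume "\<nexists>j. s $ j \<noteq> 0"
    then show False using assms by (simp add: l1_def)
  qed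
  then obtain j where j: "s $ j \<noteq> 0" by blast
  have "l1 s = \<bar>s $ j\<bar> + (\<Sum>i\<in>UNIV - {j}. \<bar>s $ i\<bar>)"
    unfolding l1_def by (subst sum.remove[of _ j]) auto
  moreover have "0 \<le> (\<Sum>i\<in>UNIV - {j}. \<bar>s $ i\<bar>)" by (rule sum_nonneg) simp
  ultimately have sj: "\<bar>s $ j\<bar> = 1" and rest: "(\<Sum>i\<in>UNIV - {j}. \<bar>s $ i\<bar>) = 0"
    using assms j by linarith+
  from rest have "s $ i = 0" if "i \<noteq> j" for i
    using that by (subst (asm) sum_nonneg_eq_0_iff) auto
  then have "s = axis j (s $ j)" by (auto simp: vec_eq_iff axis_def)
  moreover have "s $ j = 1 \<or> s $ j = - 1" using sj by arith
  ultimately show thesis using that by blast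
qed

text \<open>Changing an integer by 1 or -1 lowers its absolute value exactly when it moves towards
  0, so being a step is a sign condition in a single coordinate.\<close>

lemma is_step_axis:
  assumes "\<epsilon> = 1 \<or> \<epsilon> = - 1"
  shows "is_step \<alpha> (axis j \<epsilon>) \<beta> \<longleftrightarrow> 0 < \<epsilon> * (\<beta> $ j - \<alpha> $ j)"
proof -
  have "l1 (axis j \<epsilon>) = 1" using l1_add_axis[of 0 j \<epsilon>] assms by (auto simp: l1_def)
  moreover have "l1 (\<alpha> + axis j \<epsilon> - \<beta>) = l1 (\<alpha> - \<beta>) - \<bar>\<alpha> $ j - \<beta> $ j\<bar> + \<bar>\<alpha> $ j - \<beta> $ j + \<epsilon>\<bar>"
    using l1_add_axis[of "\<alpha> - \<beta>" j \<epsilon>] by (simp add: algebra_simps)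
  ultimately show ?thesis
    unfolding is_step_def using assms by auto
qed

definition int_vec :: "nat ^ 'n \<Rightarrow> int ^ 'n"
  where "int_vec \<gamma> = (\<chi> i. int (\<gamma> $ i))"

lemma int_vec_fibre_card_toggle:
  fixes S :: "('n::finite \<times> nat) set"
  assumes "finite S"
  shows "int_vec (fibre_card (sym_diff S {e})) =
    int_vec (fibre_card S) + axis (fst e) (if e \<in> S then - 1 else 1)"
proof -
  obtain l m where e: "e = (l, m)" by (cases e)
  have "int (card {i. (x, i) \<in> sym_diff S {e}}) =
      int (card {i. (x, i) \<in> S}) + axis l (if e \<in> S then - 1 else 1) $ x" for x
  proof -
    have fin: "finite {i. (x, i) \<in> S}"
      by (rule finite_subset[of _ "snd ` S"]) (use assms in force)+
    consider "x \<noteq> l" | "x = l" "e \<in> S" | "x = l" "e \<notin> S" by blast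
    then show ?thesis
    proof cases
      case 1
      then have "{i. (x, i) \<in> sym_diff S {e}} = {i. (x, i) \<in> S}" by (auto simp: e)
      then show ?thesis using 1 by (simp add: axis_def)
    next
      case 2
      then have "{i. (x, i) \<in> sym_diff S {e}} = {i. (x, i) \<in> S} - {m}" "m \<in> {i. (x, i) \<in> S}"
        by (auto simp: e)
      moreover from this(2) have "card {i. (x, i) \<in> S} \<noteq> 0" using fin by auto
      ultimately show ?thesis using 2 fin by (simp add: axis_def of_nat_diff)
    next
      case 3
      then have "{i. (x, i) \<in> sym_diff S {e}} = insert m {i. (x, i) \<in> S}" "m \<notin> {i. (x, i) \<in> S}"
        by (auto simp: e)
      then show ?thesis using 3 fin by (simp add: axis_def)
    qed
  qed
  then show ?thesis by (simp add: vec_eq_iff int_vec_def fibre_card_def e)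
qed

text \<open>The two elements may be copies of the same variable, so that a coordinate moves by 2.
  They must differ, since otherwise only one toggle takes place.\<close>

lemma int_vec_fibre_card_toggle2:
  fixes S :: "('n::finite \<times> nat) set"
  assumes "finite S" "e \<noteq> f"
  shows "int_vec (fibre_card (sym_diff S {e, f})) = int_vec (fibre_card S)
    + axis (fst e) (if e \<in> S then - 1 else 1) + axis (fst f) (if f \<in> S then - 1 else 1)"
proof -
  have "sym_diff S {e, f} = sym_diff (sym_diff S {e}) {f}" "f \<in> sym_diff S {e} \<longleftrightarrow> f \<in> S"
    using assms(2) by auto
  then show ?thesis using assms(1) by (simp only: int_vec_fibre_card_toggle finite_Un finite_Diff finite.intros)
qed

lemma half_plane_pconst_cis:
  assumes "0 < pIm z"
  shows "pconst (cis (- \<theta>)) * z \<in> half_plane \<theta>"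
proof -
  have "pconst (exp (\<i> * complex_of_real \<theta>)) * (pconst (cis (- \<theta>)) * z) = z"
    by (simp add: mult.assoc[symmetric] pmono_mult cis_conv_exp[symmetric] cis_mult pconst_1)
  with assms show ?thesis unfolding half_plane_def puiseux_pos_iff by (simp only: mem_Collect_eq)
qed

theorem theorem1p5:
  fixes P :: "(complex puiseux, 'n::finite) mpol"
  assumes "constant_parity (supp P)"
    and "half_plane_property P"
  shows "M_concave (supp P) (trop P)"
proof -
  obtain \<theta> where \<theta>: "half_plane_stable \<theta> P" using assms(2) by (auto simp: half_plane_property_def)
  \<comment> \<open>These are the coefficients of P after the rotation z -> e^(-i\<theta>) z, which
    makes it stable for the upper half-plane without changing support or valuations.\<close>
  define a where "a \<gamma> = Poly_Mapping.lookup P \<gamma> * pconst (\<Prod>j\<in>UNIV. cis (- \<theta>) ^ (\<gamma> $ j))" for \<gamma>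
  have a_nz: "a \<gamma> \<noteq> 0 \<longleftrightarrow> Poly_Mapping.lookup P \<gamma> \<noteq> 0"
    and a_le: "leading_exponent (a \<gamma>) = leading_exponent (Poly_Mapping.lookup P \<gamma>)" for \<gamma>
    unfolding a_def by (rule times_pconst_nz, simp)+
  have keys: "{\<gamma>. a \<gamma> \<noteq> 0} = Poly_Mapping.keys P" by (auto simp: a_nz in_keys_iff)
  have nv: "(\<Sum>\<gamma> | a \<gamma> \<noteq> 0. a \<gamma> * (\<Prod>j\<in>UNIV. z j ^ (\<gamma> $ j))) \<noteq> 0" if z: "\<And>j. 0 < pIm (z j)" for z
  proof -
    have "mpol_eval P (\<chi> j. pconst (cis (- \<theta>)) * z j) \<noteq> 0"
      using \<theta> z half_plane_pconst_cis unfolding half_plane_stable_def by simp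
    also have "mpol_eval P (\<chi> j. pconst (cis (- \<theta>)) * z j) = (\<Sum>\<gamma> | a \<gamma> \<noteq> 0. a \<gamma> * (\<Prod>j\<in>UNIV. z j ^ (\<gamma> $ j)))"
      unfolding keys mpol_eval_def
      by (simp add: a_def power_mult_distrib prod.distrib pmono_power prod_pconst mult.assoc)
    finally show ?thesis .
  qed
  define k where "k = (\<Sum>\<gamma>\<in>Poly_Mapping.keys P. \<Sum>j\<in>UNIV. \<gamma> $ j)"
  have bound: "\<gamma> $ j \<le> k" if "a \<gamma> \<noteq> 0" for \<gamma> j
  proof -
    have "\<gamma> $ j \<le> (\<Sum>j\<in>UNIV. \<gamma> $ j)" by (intro member_le_sum) auto
    also have "\<dots> \<le> k" unfolding k_def
      using that keys by (intro member_le_sum[of \<gamma> _ "\<lambda>\<gamma>. \<Sum>j\<in>UNIV. \<gamma> $ j"]) auto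
    finally show ?thesis .
  qed
  define E where "E = (UNIV :: 'n set) \<times> {..<k}"
  have "finite E" by (simp add: E_def)
  define c where "c S = a (fibre_card S) * pconst (\<Prod>j\<in>UNIV. 1 / of_nat (k choose fibre_card S $ j))" for S
  have stable: "multiaffine_stable E c"
    unfolding E_def c_def by (rule polarization_stable) (use bound nv keys in auto)
  have fc: "fibre_card S $ j \<le> k" if "S \<subseteq> E" for S j
  proof -
    have "{i. (j, i) \<in> S} \<subseteq> {..<k}" using that by (auto simp: E_def)
    then show ?thesis unfolding fibre_card_def using card_mono[of "{..<k}"] by simp
  qed
  have c_nz: "c S \<noteq> 0 \<longleftrightarrow> Poly_Mapping.lookup P (fibre_card S) \<noteq> 0"
    and c_le: "leading_exponent (c S) = leading_exponent (Poly_Mapping.lookup P (fibre_card S))"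
    if "S \<subseteq> E" for S
  proof -
    have "(\<Prod>j\<in>UNIV. 1 / of_nat (k choose fibre_card S $ j)) \<noteq> (0 :: complex)"
      using fc[OF that] by (simp add: prod_zero_iff binomial_eq_0_iff not_less)
    from times_pconst_nz[OF this, of "a (fibre_card S)"]
    show "c S \<noteq> 0 \<longleftrightarrow> Poly_Mapping.lookup P (fibre_card S) \<noteq> 0"
      "leading_exponent (c S) = leading_exponent (Poly_Mapping.lookup P (fibre_card S))"
      unfolding c_def a_nz a_le by blast+
  qed
  have supp: "supp P = int_vec ` {\<gamma>. Poly_Mapping.lookup P \<gamma> \<noteq> 0}"
    unfolding supp_def int_vec_def ..
  have in_supp: "int_vec (fibre_card S) \<in> supp P" if "S \<subseteq> E" "c S \<noteq> 0" for S
    using that c_nz by (auto simp: supp)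
  have trop_eq: "trop P (int_vec \<gamma>) = leading_exponent (Poly_Mapping.lookup P \<gamma>)"
    if "Poly_Mapping.lookup P \<gamma> \<noteq> 0" for \<gamma>
    using that by (simp add: trop_def int_vec_def valuation_def)
  have card_l1: "l1 (int_vec (fibre_card S)) = int (card S)" if "S \<subseteq> E" for S
  proof -
    have fin: "finite {i. (j, i) \<in> S}" for j
      by (rule finite_subset[of _ "{..<k}"]) (use that in \<open>auto simp: E_def\<close>)
    have "S = (SIGMA j:UNIV. {i. (j, i) \<in> S})" by auto
    then have "card S = (\<Sum>j\<in>UNIV. card {i. (j, i) \<in> S})"
      using card_SigmaI[of UNIV "\<lambda>j. {i. (j, i) \<in> S}"] fin by simp
    then show ?thesis by (simp add: l1_def int_vec_def fibre_card_def)
  qed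
  have parity: "even (card S) = even (card T)" if "S \<subseteq> E" "T \<subseteq> E" "c S \<noteq> 0" "c T \<noteq> 0" for S T
    using assms(1) in_supp[of S] in_supp[of T] that card_l1
    unfolding constant_parity_def by (metis even_diff even_of_nat even_add)
  show ?thesis
    unfolding M_concave_def
  proof (intro ballI allI impI)
    fix \<alpha> \<beta> s assume "\<alpha> \<in> supp P" "\<beta> \<in> supp P" and step: "is_step \<alpha> s \<beta>"
    then obtain a' b where ab: "Poly_Mapping.lookup P a' \<noteq> 0" "\<alpha> = int_vec a'"
        "Poly_Mapping.lookup P b \<noteq> 0" "\<beta> = int_vec b"
      by (auto simp: supp)
    \<comment> \<open>Initial segments in each fibre represent the two exponent vectors. In every
      fibre one segment contains the other, so all elements of \<open>sym_diff A B\<close> there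
      point in the same direction, from \<alpha> to \<beta>.\<close>
    define A B where "A = {(j, i). i < a' $ j}" and "B = {(j, i). i < b $ j}"
    have fcA: "fibre_card A = a'" and fcB: "fibre_card B = b"
      by (simp_all add: A_def B_def fibre_card_def vec_eq_iff)
    have AE: "A \<subseteq> E" and BE: "B \<subseteq> E"
      using ab bound a_nz by (fastforce simp: A_def B_def E_def intro: less_le_trans)+
    have cA: "c A \<noteq> 0" and cB: "c B \<noteq> 0" using ab c_nz AE BE by (simp_all add: fcA fcB)
    have fins: "finite A" "finite B" using AE BE \<open>finite E\<close> finite_subset by auto
    obtain j \<epsilon> where \<epsilon>: "\<epsilon> = 1 \<or> \<epsilon> = - 1" and s: "s = axis j \<epsilon>"
      using step l1_eq_1E[of s] unfolding is_step_def by metis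
    have dir: "0 < \<epsilon> * (int (b $ j) - int (a' $ j))"
      using step unfolding s ab(2,4) is_step_axis[OF \<epsilon>] by (simp add: int_vec_def)
    \<comment> \<open>The copy next to the end of the segment of A: the first missing one for an
      increase, the last present one for a decrease. In the latter case \<open>a' $ j\<close> is
      positive, so the subtraction is exact.\<close>
    define e where "e = (j, if \<epsilon> = 1 then a' $ j else a' $ j - 1)"
    have e: "e \<in> sym_diff A B" "e \<in> A \<longleftrightarrow> \<epsilon> = - 1"
      using \<epsilon> dir by (auto simp: e_def A_def B_def)
    obtain f where f: "f \<in> sym_diff A B" "f \<noteq> e"
      "c (sym_diff A {e, f}) \<noteq> 0" "c (sym_diff B {e, f}) \<noteq> 0"
      "leading_exponent (c A) + leading_exponent (c B)
        \<le> leading_exponent (c (sym_diff A {e, f})) + leading_exponent (c (sym_diff B {e, f}))"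
      using multiaffine_exchange[OF \<open>finite E\<close> stable parity AE cA BE cB e(1)] by blast
    define \<delta> :: int where "\<delta> = (if f \<in> A then - 1 else 1)"
    define t where "t = axis (fst f) \<delta>"
    have \<delta>: "\<delta> = 1 \<or> \<delta> = - 1" by (simp add: \<delta>_def)
    have E': "sym_diff A {e, f} \<subseteq> E" "sym_diff B {e, f} \<subseteq> E" using e f AE BE by auto
    have A': "int_vec (fibre_card (sym_diff A {e, f})) = \<alpha> + s + t"
      using int_vec_fibre_card_toggle2[OF fins(1), of e f] f(2) \<epsilon> e(2)
      by (auto simp: fcA ab s t_def \<delta>_def e_def)
    \<comment> \<open>Elements of the symmetric difference lie in exactly one of A and B, so the
      same toggles move \<beta> by the opposite signs.\<close>
    have B': "int_vec (fibre_card (sym_diff B {e, f})) = \<beta> - s - t"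
    proof -
      have neg: "axis i (- x) = - axis i x" for i :: 'n and x :: int by (simp add: vec_eq_iff axis_def)
      have "e \<in> B \<longleftrightarrow> \<epsilon> = 1" "f \<in> B \<longleftrightarrow> \<delta> = 1" using e f(1) \<epsilon> by (auto simp: \<delta>_def)
      then have "axis (fst e) (if e \<in> B then - 1 else 1) = - s" "axis (fst f) (if f \<in> B then - 1 else 1) = - t"
        using \<epsilon> \<delta> by (auto simp: s t_def e_def neg)
      then show ?thesis
        using int_vec_fibre_card_toggle2[OF fins(2), of e f] f(2) by (simp add: fcB ab)
    qed
    obtain l m where lm: "f = (l, m)" by (cases f)
    \<comment> \<open>In the fibre of e the segments differ in at least two copies because
      \<open>f \<noteq> e\<close>, so coordinate j still falls short of \<beta> after s, and on the
      same side. In any other fibre s changes nothing.\<close>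
    have "0 < \<delta> * (\<beta> $ l - (\<alpha> + s) $ l)"
    proof (cases "l = j")
      case True
      then show ?thesis
        using f(1,2) \<epsilon> dir by (auto simp: lm s axis_def ab int_vec_def \<delta>_def A_def B_def e_def split: if_splits)
    next
      case False
      then show ?thesis
        using f(1) by (auto simp: lm s axis_def ab int_vec_def \<delta>_def A_def B_def)
    qed
    then have "is_step (\<alpha> + s) t \<beta>" unfolding t_def is_step_axis[OF \<delta>] by (simp add: lm)
    moreover have "\<alpha> + s + t \<in> supp P" "\<beta> - s - t \<in> supp P"
      using in_supp E' f(3,4) unfolding A'[symmetric] B'[symmetric] by blast+
    moreover have "trop P \<alpha> + trop P \<beta> \<le> trop P (\<alpha> + s + t) + trop P (\<beta> - s - t)"
    proof -
      have val: "trop P (int_vec (fibre_card S)) = leading_exponent (c S)" if "S \<subseteq> E" "c S \<noteq> 0" for S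
        using that trop_eq c_nz c_le by simp
      show ?thesis
        using f(5) val[OF AE cA] val[OF BE cB] val[OF E'(1) f(3)] val[OF E'(2) f(4)]
        unfolding A' B' fcA fcB ab(2,4) by simp
    qed
    ultimately show "\<exists>t. is_step (\<alpha> + s) t \<beta> \<and> \<alpha> + s + t \<in> supp P \<and> \<beta> - s - t \<in> supp P \<and>
        trop P \<alpha> + trop P \<beta> \<le> trop P (\<alpha> + s + t) + trop P (\<beta> - s - t)"
      by blast
  qed
qed

end
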